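(* Let $p$ be an odd prime, $n\ge1$, and $G=\langle x,y: x^{p^{n+1}}=y^{p^n}=1,\ y^{-1}xy=x^{1+p}\rangle$ (a nested GVZ $p$-group of order $p^{2n+1}$, exponent $p^{n+1}$ and nilpotency class $n+1$). Then \[\mathbb{Q}G\cong\mathbb{Q}\oplus(p+1)\mathbb{Q}(\zeta_p)\bigoplus_{r=2}^{n}p\,\mathbb{Q}(\zeta_{p^r})\bigoplus_{r=1}^{n-1}p\,M_{p^r}(\mathbb{Q}(\zeta_p))\bigoplus_{r=1}^{n-2}\bigoplus_{m=2}^{n-r}(p-1)M_{p^r}(\mathbb{Q}(\zeta_{p^m}))\oplus M_{p^n}(\mathbb{Q}(\zeta_p)).\]
   Context: $\zeta_m$ is a primitive $m$-th root of unity, $M_k(K)$ the $k\times k$ matrix algebra over $K$, $c\,A$ the direct sum of $c$ copies of $A$; empty direct sums are zero. A nested GVZ-group is a group in which every irreducible complex character $\chi$ vanishes outside $Z(\chi)=\{g:|\chi(g)|=\chi(1)\}$ and the subgroups $Z(\chi)$ are totally ordered by inclusion. *)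

theory Defs
  imports Complex_Main "HOL-Algebra.Algebra"
begin

definition zeta :: "nat \<Rightarrow> complex" where
  "zeta m = cis (2 * pi / real m)"

definition is_subfield_of_complex :: "complex set \<Rightarrow> bool" where
  "is_subfield_of_complex K \<longleftrightarrow> 0 \<in> K \<and> 1 \<in> K \<and>
     (\<forall>a\<in>K. \<forall>b\<in>K. a + b \<in> K \<and> a * b \<in> K) \<and> (\<forall>a\<in>K. - a \<in> K) \<and>
     (\<forall>a\<in>K. a \<noteq> 0 \<longrightarrow> inverse a \<in> K)"

definition cyclotomic_field :: "nat \<Rightarrow> complex set" where
  "cyclotomic_field m = \<Inter> {K. is_subfield_of_complex K \<and> zeta m \<in> K}"

definition QG_carrier :: "('a, 'b) monoid_scheme \<Rightarrow> ('a \<Rightarrow> rat) set" where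
  "QG_carrier G = {f. \<forall>g. g \<notin> carrier G \<longrightarrow> f g = 0}"

definition QG_add :: "('a \<Rightarrow> rat) \<Rightarrow> ('a \<Rightarrow> rat) \<Rightarrow> ('a \<Rightarrow> rat)" where
  "QG_add f h = (\<lambda>g. f g + h g)"

definition QG_smult :: "rat \<Rightarrow> ('a \<Rightarrow> rat) \<Rightarrow> ('a \<Rightarrow> rat)" where
  "QG_smult q f = (\<lambda>g. q * f g)"

definition QG_mult :: "('a, 'b) monoid_scheme \<Rightarrow> ('a \<Rightarrow> rat) \<Rightarrow> ('a \<Rightarrow> rat) \<Rightarrow> ('a \<Rightarrow> rat)" where
  "QG_mult G f h = (\<lambda>g. if g \<in> carrier G
      then (\<Sum>a\<in>carrier G. f a * h (inv\<^bsub>G\<^esub> a \<otimes>\<^bsub>G\<^esub> g)) else 0)"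

definition QG_one :: "('a, 'b) monoid_scheme \<Rightarrow> ('a \<Rightarrow> rat)" where
  "QG_one G = (\<lambda>g. if g = \<one>\<^bsub>G\<^esub> then 1 else 0)"

text \<open>A block list L = [(k_1,m_1),...,(k_s,m_s)] stands for the direct sum of the
  algebras M_{k_b}(Q(zeta_{m_b})), b < s.  An element is a function D b i j (block b,
  row i, column j), with entries of block b in Q(zeta_{m_b}) and zero outside the blocks.\<close>

type_synonym blocks = "(nat \<times> nat) list"
type_synonym dsum_elem = "nat \<Rightarrow> nat \<Rightarrow> nat \<Rightarrow> complex"

definition in_block :: "blocks \<Rightarrow> nat \<Rightarrow> nat \<Rightarrow> nat \<Rightarrow> bool" where
  "in_block L b i j \<longleftrightarrow> b < length L \<and> i < fst (L ! b) \<and> j < fst (L ! b)"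

definition dsum_carrier :: "blocks \<Rightarrow> dsum_elem set" where
  "dsum_carrier L = {D. \<forall>b i j. (if in_block L b i j
      then D b i j \<in> cyclotomic_field (snd (L ! b)) else D b i j = 0)}"

definition dsum_add :: "dsum_elem \<Rightarrow> dsum_elem \<Rightarrow> dsum_elem" where
  "dsum_add D E = (\<lambda>b i j. D b i j + E b i j)"

definition dsum_smult :: "rat \<Rightarrow> dsum_elem \<Rightarrow> dsum_elem" where
  "dsum_smult q D = (\<lambda>b i j. of_rat q * D b i j)"

definition dsum_mult :: "blocks \<Rightarrow> dsum_elem \<Rightarrow> dsum_elem \<Rightarrow> dsum_elem" where
  "dsum_mult L D E = (\<lambda>b i j. if in_block L b i j
      then (\<Sum>l<fst (L ! b). D b i l * E b l j) else 0)"

definition dsum_one :: "blocks \<Rightarrow> dsum_elem" where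
  "dsum_one L = (\<lambda>b i j. if in_block L b i j \<and> i = j then 1 else 0)"

definition QG_iso_dsum :: "('a, 'b) monoid_scheme \<Rightarrow> blocks \<Rightarrow> bool" where
  "QG_iso_dsum G L \<longleftrightarrow> (\<exists>\<phi>. bij_betw \<phi> (QG_carrier G) (dsum_carrier L) \<and>
     (\<forall>f\<in>QG_carrier G. \<forall>h\<in>QG_carrier G.
        \<phi> (QG_add f h) = dsum_add (\<phi> f) (\<phi> h) \<and>
        \<phi> (QG_mult G f h) = dsum_mult L (\<phi> f) (\<phi> h)) \<and>
     (\<forall>q. \<forall>f\<in>QG_carrier G. \<phi> (QG_smult q f) = dsum_smult q (\<phi> f)) \<and>
     \<phi> (QG_one G) = dsum_one L)"

text \<open>The block list of Theorem 5.4: (k,m) means M_k(Q(zeta_m)); Q = M_1(Q(zeta_1)).\<close>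
definition thm54_blocks :: "nat \<Rightarrow> nat \<Rightarrow> blocks" where
  "thm54_blocks p n =
     [(1, 1)]
     @ replicate (p + 1) (1, p)
     @ concat (map (\<lambda>r. replicate p (1, p ^ r)) [2..<n + 1])
     @ concat (map (\<lambda>r. replicate p (p ^ r, p)) [1..<n])
     @ concat (map (\<lambda>r. concat (map (\<lambda>m. replicate (p - 1) (p ^ r, p ^ m)) [2..<n - r + 1]))
                   [1..<n - 1])
     @ [(p ^ n, p)]"

end

(*
  The rational irreducible representations of G are written down explicitly: for each parameter
  (r, M, s, t) there are matrices X, Y of size p^r over Q(zeta_(p^M)) with XY = YX^(1+p) such that X^(p^r)
  and Y^(p^r) are the scalars zeta_p^s and zeta_(p^M)^t.  Conjugating by powers of X and Y shows that the
  trace of Y^j X^i vanishes unless p^r divides i and j.  Together the representations map QG to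
  the direct sum.  This map is injective: if f is killed by all of them, then so are the translates of f,
  hence all rational traces of these vanish; these traces, weighted by the degrees, add up to the
  regular character, which reads off the coefficients of f.  The passage from a relation between
  roots of unity to a relation between their rational traces is where irreducibility of the
  cyclotomic polynomials over Q (Eisenstein) enters.  Evaluating the same sum at the identity shows
  that the direct sum has dimension at most |G|, so the map is also surjective.
*)

theory Submission
  imports Defs "Berlekamp_Zassenhaus.Factor_Bound" "Jordan_Normal_Form.Matrix"
    "HOL-Library.Function_Algebras"
begin

section \<open>Geometric sums modulo prime powers\<close>

text \<open>For r > 0 the eigenvalues of X are roots of unity of order p^(r+1), while the field
  Q(zeta_(p^M)) of the block can be as small as Q(zeta_p). Diagonalising X thus leaves the field as
  soon as M <= r. This obstacle shapes the matrices: they permute a basis with two indices up to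
  powers of zeta_(p^M), and X is diagonal only when M is large enough. Rational traces are handled
  without Galois groups. The trace is a linear functional on polynomials, given by the closed form
  of the Ramanujan sum, that vanishes on multiples of the minimal polynomial. Oddness of p enters
  through two p-adic facts. A sum of p powers of v, with v = 1 modulo p^N, is p modulo p^(N+1); this
  determines Y^(p^r). And (1+p)^k - 1 has p-adic valuation exactly one more than k; this makes the
  scalars arising from conjugation different from 1.\<close>

lemma geometric_sum_mult:
  fixes u :: "'a :: idom"
  shows "(\<Sum>i<m * k. u ^ i) = (\<Sum>i<m. (u ^ k) ^ i) * (\<Sum>i<k. u ^ i)"
proof (cases "u = 1")
  case False
  have "(u - 1) * (\<Sum>i<m * k. u ^ i) = u ^ (m * k) - 1"
    by (simp add: power_diff_1_eq)
  also have "\<dots> = (u ^ k) ^ m - 1"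
    by (simp add: power_mult mult.commute)
  also have "\<dots> = (u - 1) * ((\<Sum>i<m. (u ^ k) ^ i) * (\<Sum>i<k. u ^ i))"
    by (simp add: power_diff_1_eq mult_ac)
  finally show ?thesis using False by simp
qed simp

text \<open>Only the linear binomial term survives, because \<open>2 * N \<ge> N + 1\<close> for
  \<open>N \<ge> 1\<close>.\<close>

lemma power_one_plus_cong:
  fixes q w :: int
  assumes "N \<ge> 1"
  shows "[(1 + q ^ N * w) ^ c = 1 + int c * q ^ N * w] (mod q ^ (N + 1))"
proof (induction c)
  case (Suc c)
  have "q ^ (N + 1) dvd q ^ N * q ^ N"
    by (metis assms add.commute add_le_cancel_right le_imp_power_dvd power_add)
  then have "[int c * w * w * (q ^ N * q ^ N) = 0] (mod q ^ (N + 1))"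
    by (simp add: cong_0_iff)
  moreover have "(1 + int c * q ^ N * w) * (1 + q ^ N * w) =
      1 + int (Suc c) * q ^ N * w + int c * w * w * (q ^ N * q ^ N)"
    by (simp add: algebra_simps)
  ultimately have "[(1 + int c * q ^ N * w) * (1 + q ^ N * w) = 1 + int (Suc c) * q ^ N * w] (mod q ^ (N + 1))"
    by (metis add.right_neutral cong_add_lcancel)
  moreover have "[(1 + q ^ N * w) ^ Suc c = (1 + int c * q ^ N * w) * (1 + q ^ N * w)] (mod q ^ (N + 1))"
    using cong_scalar_right[OF Suc] by (simp add: mult.commute)
  ultimately show ?case by (rule cong_trans[rotated])
qed simp

text \<open>The linear terms add up to \<open>p ^ N * w\<close> times p(p-1)/2. For odd
  \<open>p\<close> the factor (p-1)/2 is an integer, which gains the extra \<open>p\<close>; for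
  \<open>p = 2\<close> the congruence fails.\<close>

lemma geometric_sum_cong_odd:
  fixes v :: int
  assumes "odd p" "N \<ge> 1" "[v = 1] (mod int p ^ N)"
  shows "[(\<Sum>c<p. v ^ c) = int p] (mod int p ^ (N + 1))"
proof -
  obtain w where w: "v = 1 + int p ^ N * w"
    using assms(3) by (metis cong_iff_lin cong_sym)
  obtain h where h: "p = 2 * h + 1" using assms(1) by (rule oddE)
  have g: "2 * (\<Sum>c<k. int c) = int k * (int k - 1)" for k
    by (induction k) (auto simp: algebra_simps)
  have "2 * (\<Sum>c<p. int c) = 2 * (int p * int h)"
    unfolding g using h by simp
  then have s: "(\<Sum>c<p. int c) = int p * int h" by simp
  have "[(\<Sum>c<p. v ^ c) = (\<Sum>c<p. 1 + int c * int p ^ N * w)] (mod int p ^ (N + 1))"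
    unfolding w by (intro cong_sum power_one_plus_cong assms)
  also have "(\<Sum>c<p. 1 + int c * int p ^ N * w) = int p + (\<Sum>c<p. int c) * (int p ^ N * w)"
    by (simp add: sum.distrib sum_distrib_right mult.assoc)
  also have "\<dots> = int p + int p ^ (N + 1) * (int h * w)"
    unfolding s by (simp add: mult_ac)
  also have "[\<dots> = int p] (mod int p ^ (N + 1))"
    by (simp add: cong_iff_dvd_diff)
  finally show ?thesis .
qed

text \<open>The sum splits into \<open>p\<close> powers of \<open>u ^ p ^ a\<close> times
  \<open>p ^ a\<close> powers of \<open>u\<close>. Both factors are a power of \<open>p\<close>
  times a number that is 1 modulo \<open>p ^ M\<close>, so each step gains one factor
  \<open>p\<close> in the value and in the modulus.\<close>

lemma geometric_sum_prime_power_cong: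
  fixes u :: int
  assumes "odd p" "M \<ge> 1" "[u = 1] (mod int p ^ M)"
  shows "[(\<Sum>i<p ^ a. u ^ i) = int p ^ a] (mod int p ^ (a + M))"
proof (induction a)
  case (Suc a)
  obtain y where y: "(\<Sum>i<p ^ a. u ^ i) = int p ^ a + int p ^ (a + M) * y"
    using Suc by (metis cong_iff_lin cong_sym)
  have "u ^ p ^ a - 1 = (u - 1) * (int p ^ a + int p ^ (a + M) * y)"
    by (simp add: power_diff_1_eq y)
  also have "\<dots> = (u - 1) * (int p ^ a * (1 + int p ^ M * y))"
    by (simp add: algebra_simps power_add)
  finally have "int p ^ M dvd u ^ p ^ a - 1"
    using assms(3) by (simp add: cong_iff_dvd_diff)
  then have "[u ^ p ^ a = 1] (mod int p ^ M)"
    by (simp add: cong_iff_dvd_diff)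
  from geometric_sum_cong_odd[OF assms(1,2) this]
  obtain z where z: "(\<Sum>c<p. (u ^ p ^ a) ^ c) = int p + int p ^ (M + 1) * z"
    by (metis cong_iff_lin cong_sym)
  have "(\<Sum>i<p ^ Suc a. u ^ i) =
     (int p + int p ^ (M + 1) * z) * (int p ^ a + int p ^ (a + M) * y)"
    using geometric_sum_mult[of u p "p ^ a"] by (simp only: y z power_Suc)
  also have "\<dots> = int p ^ Suc a + int p ^ (Suc a + M) * (y + z + int p ^ M * y * z)"
    by (simp add: algebra_simps power_add)
  finally show ?case by (simp add: cong_iff_dvd_diff)
qed simp

lemma power_prime_power_cong_1:
  fixes u :: int
  assumes "odd p" "M \<ge> 1" "[u = 1] (mod int p ^ M)"
  shows "[u ^ p ^ a = 1] (mod int p ^ (a + M))"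
proof -
  obtain y where y: "(\<Sum>i<p ^ a. u ^ i) = int p ^ a + int p ^ (a + M) * y"
    using geometric_sum_prime_power_cong[OF assms] by (metis cong_iff_lin cong_sym)
  obtain z where z: "u - 1 = int p ^ M * z"
    using assms(3) by (auto simp: cong_iff_dvd_diff dvd_def)
  have "u ^ p ^ a - 1 = (int p ^ M * z) * (int p ^ a + int p ^ (a + M) * y)"
    by (simp add: power_diff_1_eq y z)
  also have "\<dots> = int p ^ (a + M) * (z * (1 + int p ^ M * y))"
    by (simp add: algebra_simps power_add)
  finally show ?thesis by (simp add: cong_iff_dvd_diff)
qed

text \<open>Lifting the exponent in exact form. The difference to 1 is the product of
  \<open>p\<close>, a sum of \<open>p ^ v\<close> powers, which is \<open>p ^ v\<close> times a unit
  modulo \<open>p\<close>, and \<open>T\<close>, which is congruent to \<open>j\<close>. Exactness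
  matters: \<open>w\<close> becomes the exponent of a primitive p-th root of unity.\<close>

lemma one_plus_prime_power_valuation:
  assumes "Factorial_Ring.prime p" "odd p" "\<not> p dvd j"
  obtains w where "(1 + p) ^ (p ^ v * j) = 1 + p ^ (v + 1) * w" "\<not> p dvd w"
proof -
  define u where "u = 1 + int p"
  have u: "[u = 1] (mod int p ^ 1)" by (simp add: u_def cong_iff_dvd_diff)
  obtain y where y: "(\<Sum>i<p ^ v. u ^ i) = int p ^ v + int p ^ (v + 1) * y"
    using geometric_sum_prime_power_cong[OF assms(2) _ u, of v] by (metis cong_iff_lin cong_sym le_refl)
  define T where "T = (\<Sum>i<j. (u ^ p ^ v) ^ i)"
  have "[T = (\<Sum>i<j. (1 ^ p ^ v) ^ i)] (mod int p ^ 1)"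
    unfolding T_def by (intro cong_sum cong_pow u)
  then have "[T = int j] (mod int p)" by simp
  then have T: "\<not> int p dvd T"
    using assms(3) by (metis cong_dvd_iff int_dvd_int_iff)
  have "u ^ (p ^ v * j) - 1 = int p * (T * (int p ^ v + int p ^ (v + 1) * y))"
  proof -
    have "u ^ (p ^ v * j) - 1 = (u - 1) * (\<Sum>i<j * p ^ v. u ^ i)"
      by (metis mult.commute power_diff_1_eq)
    then show ?thesis
      by (simp only: geometric_sum_mult T_def y) (simp add: u_def)
  qed
  also have "\<dots> = int p ^ (v + 1) * (T * (1 + int p * y))"
    by (simp add: algebra_simps)
  finally have eq: "u ^ (p ^ v * j) - 1 = int p ^ (v + 1) * (T * (1 + int p * y))" .
  define W where "W = T * (1 + int p * y)"
  have "\<not> int p dvd 1 + int p * y"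
    using assms(1) by (metis dvd_add_left_iff dvd_triv_left int_dvd_int_iff int_ops(2) not_prime_1 nat_dvd_1_iff_1)
  then have W: "\<not> int p dvd W"
    using T assms(1) by (simp add: W_def prime_dvd_mult_iff)
  \<comment> \<open>Nonnegativity of \<open>W\<close> carries the integer factorisation back to the
    natural numbers.\<close>
  have "u ^ (p ^ v * j) \<ge> 1" by (simp add: u_def)
  then have "0 \<le> int p ^ (v + 1) * W" using eq by (simp add: W_def)
  moreover have "0 < int p ^ (v + 1)" using assms(1) prime_gt_0_nat by simp
  ultimately have "0 \<le> W" by (metis zero_le_mult_iff not_less)
  then obtain w where w: "W = int w" using zero_le_imp_eq_int by blast
  have "int ((1 + p) ^ (p ^ v * j)) = int (1 + p ^ (v + 1) * w)"
    using eq by (simp add: W_def[symmetric] w u_def)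
  then have "(1 + p) ^ (p ^ v * j) = 1 + p ^ (v + 1) * w" by (simp only: of_nat_eq_iff)
  moreover have "\<not> p dvd w" using W w by simp
  ultimately show ?thesis by (rule that)
qed

section \<open>Cyclotomic polynomials of prime power order\<close>

text \<open>Since \<open>q ^ 2\<close> does not divide the constant coefficient, some factor
  \<open>h\<close> has a constant coefficient prime to \<open>q\<close>. The least index at which
  the other factor has a coefficient prime to \<open>q\<close> gives such a coefficient of
  \<open>f\<close> too, so it is at least the degree of \<open>f\<close>, and the other factor has
  full degree.\<close>

lemma eisenstein_criterion:
  fixes f :: "int poly"
  assumes "Factorial_Ring.prime q" and "Polynomial.degree f > 0" and "\<not> q dvd lead_coeff f"
    and "\<And>i. i < Polynomial.degree f \<Longrightarrow> q dvd poly.coeff f i" and "\<not> q ^ 2 dvd poly.coeff f 0"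
  shows "irreducible\<^sub>d f"
proof -
  have *: "Polynomial.degree g = Polynomial.degree f"
    if f: "f = g * h" and h: "\<not> q dvd poly.coeff h 0" for g h
  proof -
    have nz: "g \<noteq> 0" "h \<noteq> 0" using f assms(2) by auto
    have "\<not> q dvd lead_coeff g" using assms(3) unfolding f lead_coeff_mult by auto
    then have ex: "\<exists>i. \<not> q dvd poly.coeff g i" by blast
    define i where "i = (LEAST i. \<not> q dvd poly.coeff g i)"
    have i: "\<not> q dvd poly.coeff g i" unfolding i_def using ex by (rule LeastI_ex)
    have less: "q dvd poly.coeff g k" if "k < i" for k
      using not_less_Least that unfolding i_def by blast
    have "poly.coeff f i = poly.coeff g i * poly.coeff h 0 + (\<Sum>k<i. poly.coeff g k * poly.coeff h (i - k))"
      unfolding f coeff_mult by (simp add: lessThan_Suc_atMost[symmetric])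
    moreover have "q dvd (\<Sum>k<i. poly.coeff g k * poly.coeff h (i - k))"
      by (intro dvd_sum dvd_mult2 less) simp
    moreover have "\<not> q dvd poly.coeff g i * poly.coeff h 0"
      using i h assms(1) by (simp add: prime_dvd_mult_iff)
    ultimately have "\<not> q dvd poly.coeff f i" by (simp add: dvd_add_left_iff)
    then have "Polynomial.degree f \<le> i" using assms(4) by (meson not_le)
    moreover have "i \<le> Polynomial.degree g" using i by (metis dvd_0_right le_degree)
    moreover have "Polynomial.degree g \<le> Polynomial.degree f"
      unfolding f using nz by (simp add: degree_mult_eq)
    ultimately show ?thesis by simp
  qed
  show ?thesis
  proof (rule irreducible\<^sub>dI)
    fix g h
    assume deg: "Polynomial.degree g < Polynomial.degree f" "Polynomial.degree h < Polynomial.degree f"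
      and f: "f = g * h"
    have "\<not> q dvd poly.coeff g 0 \<or> \<not> q dvd poly.coeff h 0"
      using assms(5) unfolding f by (auto simp: coeff_mult power2_eq_square intro: mult_dvd_mono)
    then show False using *[of g h] *[of h g] f deg by (auto simp: mult.commute)
  qed (fact assms)
qed

lemma prime_dvd_freshman:
  fixes a :: "'a :: comm_ring_1"
  assumes "Factorial_Ring.prime p"
  shows "of_nat p dvd (1 + a) ^ p - (1 + a ^ p)"
proof -
  have p: "p > 0" using assms prime_gt_0_nat by blast
  have "(1 + a) ^ p = (\<Sum>k\<le>p. of_nat (p choose k) * a ^ k)"
    using binomial_ring[of a 1 p] by (simp add: add.commute)
  also have "{..p} = insert 0 (insert p {1..<p})" using p by auto
  also have "(\<Sum>k\<in>\<dots>. of_nat (p choose k) * a ^ k) =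
      1 + a ^ p + (\<Sum>k\<in>{1..<p}. of_nat (p choose k) * a ^ k)"
    using p by simp
  finally have "(1 + a) ^ p - (1 + a ^ p) = (\<Sum>k\<in>{1..<p}. of_nat (p choose k) * a ^ k)" by simp
  moreover have "of_nat p dvd \<dots>"
  proof (intro dvd_sum dvd_mult2)
    fix k assume "k \<in> {1..<p}"
    then have "p dvd (p choose k)" using assms by (auto intro: dvd_choose_prime)
    then show "(of_nat p :: 'a) dvd of_nat (p choose k)" by (metis dvd_def of_nat_mult)
  qed
  ultimately show ?thesis by simp
qed

lemma prime_dvd_freshman_power:
  fixes a :: "'a :: comm_ring_1"
  assumes "Factorial_Ring.prime p"
  shows "of_nat p dvd (1 + a) ^ p ^ k - (1 + a ^ p ^ k)"
proof (induction k)
  case (Suc k)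
  have pow: "x - y dvd x ^ m - y ^ m" for x y :: 'a and m
    by (cases m) (simp_all only: power_0 diff_self dvd_0_right diff_power_eq_sum dvd_triv_left)
  have "of_nat p dvd ((1 + a) ^ p ^ k) ^ p - (1 + a ^ p ^ k) ^ p"
    using Suc pow by (rule dvd_trans)
  moreover have "of_nat p dvd (1 + a ^ p ^ k) ^ p - (1 + (a ^ p ^ k) ^ p)"
    by (rule prime_dvd_freshman[OF assms])
  ultimately have "of_nat p dvd (((1 + a) ^ p ^ k) ^ p - (1 + a ^ p ^ k) ^ p) +
      ((1 + a ^ p ^ k) ^ p - (1 + (a ^ p ^ k) ^ p))"
    by (rule dvd_add)
  then show ?case unfolding power_mult[symmetric] power_Suc2[of p k] add_diff_eq diff_add_cancel .
qed simp

text \<open>For prime \<open>p\<close> this is the cyclotomic polynomial of order p^(k+1), with the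
  index shifted by one. The coefficient ring is left open because irreducibility passes from the
  integers to the rationals.\<close>

definition pp_cyclotomic :: "nat \<Rightarrow> nat \<Rightarrow> 'a :: comm_ring_1 poly" where
  "pp_cyclotomic p k = (\<Sum>c<p. Polynomial.monom 1 (c * p ^ k))"

lemma coeff_pp_cyclotomic:
  "poly.coeff (pp_cyclotomic p k) i = (\<Sum>c<p. if c * p ^ k = i then 1 else 0)"
  by (simp add: pp_cyclotomic_def coeff_sum)

lemma degree_pp_cyclotomic:
  assumes "p > 0"
  shows "Polynomial.degree (pp_cyclotomic p k :: 'a :: comm_ring_1 poly) = (p - 1) * p ^ k"
proof (rule antisym)
  show "Polynomial.degree (pp_cyclotomic p k :: 'a poly) \<le> (p - 1) * p ^ k"
    unfolding pp_cyclotomic_def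
    by (intro degree_sum_le) (auto intro!: order_trans[OF degree_monom_le])
  have "poly.coeff (pp_cyclotomic p k :: 'a poly) ((p - 1) * p ^ k) = (\<Sum>c<p. if c = p - 1 then 1 else 0)"
    unfolding coeff_pp_cyclotomic using assms by (intro sum.cong) auto
  also have "\<dots> = 1" using assms by simp
  finally show "(p - 1) * p ^ k \<le> Polynomial.degree (pp_cyclotomic p k :: 'a poly)"
    by (intro le_degree) simp
qed

lemma poly_pp_cyclotomic: "poly (pp_cyclotomic p k) x = (\<Sum>c<p. (x ^ p ^ k) ^ c)"
  by (simp add: pp_cyclotomic_def poly_sum poly_monom mult.commute flip: power_mult)

text \<open>With \<open>Z\<close> the indeterminate, ((1+Z)^(p^k) - 1) f = (1+Z)^(p^(k+1)) - 1
  reduces modulo \<open>p\<close> to Z^(p^k) f = Z^(p^(k+1)). Comparing coefficients at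
  \<open>i + p ^ k\<close> gives the claim, so \<open>f\<close> is a single monomial modulo
  \<open>p\<close>.\<close>

lemma pp_cyclotomic_shift_coeff:
  fixes k :: nat and f :: "int poly"
  assumes p: "Factorial_Ring.prime p"
  defines "f \<equiv> pp_cyclotomic p k \<circ>\<^sub>p [:1, 1:]"
  shows "int p dvd poly.coeff f i - (if i = (p - 1) * p ^ k then 1 else 0)"
proof -
  define Z where "Z = (Polynomial.monom 1 1 :: int poly)"
  have Z: "[:1, 1:] = 1 + Z" by (auto simp: Z_def poly_eq_iff coeff_pCons split: nat.splits)
  have Zp: "Z ^ m = Polynomial.monom 1 m" for m
    unfolding Z_def by (rule x_pow_n)
  have p0: "p > 0" using p prime_gt_0_nat by blast
  have f: "f = (\<Sum>c<p. ((1 + Z) ^ p ^ k) ^ c)"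
  proof -
    have "(pp_cyclotomic p k :: int poly) = (\<Sum>c<p. Z ^ (p ^ k * c))"
      unfolding pp_cyclotomic_def by (intro sum.cong refl) (simp only: Zp mult.commute[of "p ^ k"])
    moreover have "Z ^ m \<circ>\<^sub>p [:1, 1:] = (1 + Z) ^ m" for m
    proof (induction m)
      case (Suc m)
      have "Z \<circ>\<^sub>p [:1, 1:] = 1 + Z" unfolding Z[symmetric] by (simp add: Z_def monom_Suc pcompose_pCons)
      with Suc show ?case by (simp only: power_Suc pcompose_mult)
    qed (simp add: pcompose_1)
    ultimately have "f = (\<Sum>c<p. (1 + Z) ^ (p ^ k * c))"
      by (simp only: f_def pcompose_sum)
    also have "\<dots> = (\<Sum>c<p. ((1 + Z) ^ p ^ k) ^ c)"
      by (intro sum.cong refl power_mult)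
    finally show ?thesis .
  qed
  have "((1 + Z) ^ p ^ k - 1) * f = ((1 + Z) ^ p ^ k) ^ p - 1"
    by (subst f) (rule power_diff_1_eq[of "(1 + Z) ^ p ^ k" p, symmetric])
  then have "((1 + Z) ^ p ^ k - 1) * f = (1 + Z) ^ p ^ Suc k - 1"
    by (simp only: power_mult[symmetric] power_Suc2[of p k])
  then have "Z ^ p ^ k * f - Z ^ p ^ Suc k =
      ((1 + Z) ^ p ^ Suc k - (1 + Z ^ p ^ Suc k)) - ((1 + Z) ^ p ^ k - (1 + Z ^ p ^ k)) * f"
    by (simp add: algebra_simps)
  moreover have "of_nat p dvd ((1 + Z) ^ p ^ Suc k - (1 + Z ^ p ^ Suc k)) - ((1 + Z) ^ p ^ k - (1 + Z ^ p ^ k)) * f"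
    by (intro dvd_diff dvd_mult2 prime_dvd_freshman_power p)
  ultimately have "of_nat p dvd Z ^ p ^ k * f - Z ^ p ^ Suc k" by (simp only:)
  then have "int p dvd poly.coeff (Z ^ p ^ k * f - Z ^ p ^ Suc k) (i + p ^ k)"
    unfolding of_nat_poly const_poly_dvd_iff by simp
  moreover have "(p ^ Suc k = i + p ^ k) \<longleftrightarrow> (i = (p - 1) * p ^ k)"
    using p0 by (auto simp: algebra_simps)
  ultimately show ?thesis
    unfolding Zp by (simp add: coeff_monom_mult)
qed

text \<open>Eisenstein applies after substituting 1 + Z for the indeterminate; the substitution
  preserves products and degrees, so a proper factorisation would survive it.\<close>

lemma irreducible_pp_cyclotomic_int:
  assumes p: "Factorial_Ring.prime p"
  shows "irreducible\<^sub>d (pp_cyclotomic p k :: int poly)"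
proof -
  let ?F = "pp_cyclotomic p k :: int poly"
  define f where "f = ?F \<circ>\<^sub>p [:1, 1:]"
  have p1: "p > 1" using p prime_gt_1_nat by blast
  have deg: "Polynomial.degree f = (p - 1) * p ^ k"
    unfolding f_def using p1 by (simp add: degree_pp_cyclotomic)
  note co = pp_cyclotomic_shift_coeff[OF p, of k, folded f_def]
  have "irreducible\<^sub>d f"
  proof (rule eisenstein_criterion)
    show "Factorial_Ring.prime (int p)" using p by simp
    show "0 < Polynomial.degree f" using p1 by (simp add: deg)
    show "\<not> int p dvd lead_coeff f"
    proof
      assume "int p dvd lead_coeff f"
      moreover have "int p dvd lead_coeff f - 1"
        using co[of "(p - 1) * p ^ k"] unfolding deg by simp
      ultimately have "int p dvd lead_coeff f - (lead_coeff f - 1)"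
        by (rule dvd_diff)
      then show False using p1 by simp
    qed
    show "int p dvd poly.coeff f i" if "i < Polynomial.degree f" for i
      using co[of i] that unfolding deg by simp
    \<comment> \<open>The constant coefficient after the shift is the value at 1, a sum of
      \<open>p\<close> ones.\<close>
    have "poly.coeff f 0 = int p"
      by (simp add: f_def poly_0_coeff_0[symmetric] poly_pcompose poly_pp_cyclotomic)
    moreover have "\<not> (int p) ^ 2 dvd int p"
      using p1 zdvd_imp_le[of "int p ^ 2" "int p"] by (auto simp: power2_eq_square)
    ultimately show "\<not> (int p) ^ 2 dvd poly.coeff f 0" by simp
  qed
  show ?thesis
  proof (rule irreducible\<^sub>dI)
    show "0 < Polynomial.degree ?F" using p1 by (simp add: degree_pp_cyclotomic)
    fix g h assume "Polynomial.degree g < Polynomial.degree ?F" "Polynomial.degree h < Polynomial.degree ?F" "?F = g * h"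
    note gh = this
    have "f = (g \<circ>\<^sub>p [:1, 1:]) * (h \<circ>\<^sub>p [:1, 1:])"
      unfolding f_def gh(3) by (rule pcompose_mult)
    moreover have d: "Polynomial.degree (q \<circ>\<^sub>p [:1, 1:]) = Polynomial.degree q" for q :: "int poly"
      by simp
    moreover have "Polynomial.degree (g \<circ>\<^sub>p [:1, 1:]) < Polynomial.degree f"
      unfolding f_def d by (rule gh(1))
    moreover have "Polynomial.degree (h \<circ>\<^sub>p [:1, 1:]) < Polynomial.degree f"
      unfolding f_def d by (rule gh(2))
    ultimately show False
      using irreducible\<^sub>dD(2)[OF \<open>irreducible\<^sub>d f\<close>] by blast
  qed
qed

lemma irreducible_pp_cyclotomic_rat:
  assumes "Factorial_Ring.prime p"
  shows "Factorial_Ring.irreducible (pp_cyclotomic p k :: rat poly)"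
proof -
  have "map_poly rat_of_int (pp_cyclotomic p k) = pp_cyclotomic p k"
    by (intro poly_eqI) (simp add: coeff_pp_cyclotomic coeff_map_poly if_distrib cong: if_cong)
  then show ?thesis
    using irreducible\<^sub>d_int_rat[OF irreducible_pp_cyclotomic_int[OF assms, of k]]
    by simp
qed

section \<open>Rational polynomials at complex numbers and the fields they generate\<close>

abbreviation rat_poly_eval :: "rat poly \<Rightarrow> complex \<Rightarrow> complex" where
  "rat_poly_eval f z \<equiv> poly (map_poly of_rat f) z"

lemma rat_poly_eval_mult: "rat_poly_eval (f * g) z = rat_poly_eval f z * rat_poly_eval g z"
proof -
  interpret map_poly_comm_ring_hom "of_rat :: rat \<Rightarrow> complex" ..
  show ?thesis by (simp add: hom_mult)
qed

lemma rat_poly_eval_add: "rat_poly_eval (f + g) z = rat_poly_eval f z + rat_poly_eval g z"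
  by (simp add: hom_distribs)

lemma rat_poly_eval_sum: "rat_poly_eval (\<Sum>i\<in>A. f i) z = (\<Sum>i\<in>A. rat_poly_eval (f i) z)"
  by (induction A rule: infinite_finite_induct) (simp_all add: rat_poly_eval_add)

lemma rat_poly_eval_altdef:
  "Polynomial.degree f < n \<Longrightarrow> rat_poly_eval f z = (\<Sum>k<n. of_rat (poly.coeff f k) * z ^ k)"
  unfolding poly_altdef
  by (rule sum.mono_neutral_cong_left) (auto simp: coeff_eq_0)

lemma irreducible_coprime_or_dvd:
  fixes P f :: "rat poly"
  assumes "Factorial_Ring.irreducible P" "\<not> P dvd f"
  obtains g h where "g * f + h * P = 1"
proof -
  have "prime_elem P" using assms(1) by (rule field_poly_irreducible_imp_prime)
  then have "gcd f P = 1"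
    using assms(2) prime_elem_imp_coprime coprime_iff_gcd_eq_1 gcd.commute by metis
  then show ?thesis using bezout_coefficients_fst_snd[of f P] that by metis
qed

lemma irreducible_root_dvd:
  assumes "Factorial_Ring.irreducible P" "rat_poly_eval P z = 0" "rat_poly_eval f z = 0"
  shows "P dvd f"
proof (rule ccontr)
  assume "\<not> P dvd f"
  then obtain g h where "g * f + h * P = 1" using irreducible_coprime_or_dvd[OF assms(1)] by blast
  then have "rat_poly_eval (g * f + h * P) z = 1" by simp
  then show False using assms(2,3) by (simp add: rat_poly_eval_add rat_poly_eval_mult)
qed

text \<open>\<open>cyclotomic_field\<close> is an intersection of subfields, so bounding it from
  above requires exhibiting one. Here it is Q[z], with inverses from Bezout coefficients against the
  irreducible polynomial of \<open>z\<close>.\<close>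

lemma subfield_range_rat_poly_eval:
  assumes "Factorial_Ring.irreducible P" "rat_poly_eval P z = 0"
  shows "is_subfield_of_complex (range (\<lambda>f. rat_poly_eval f z))"
  unfolding is_subfield_of_complex_def
proof (intro conjI ballI impI)
  show "0 \<in> range (\<lambda>f. rat_poly_eval f z)" by (rule range_eqI[of _ _ 0]) simp
  show "1 \<in> range (\<lambda>f. rat_poly_eval f z)" by (rule range_eqI[of _ _ 1]) simp
next
  fix a b assume "a \<in> range (\<lambda>f. rat_poly_eval f z)" "b \<in> range (\<lambda>f. rat_poly_eval f z)"
  then show "a + b \<in> range (\<lambda>f. rat_poly_eval f z)" "a * b \<in> range (\<lambda>f. rat_poly_eval f z)"
    by (auto simp flip: rat_poly_eval_add rat_poly_eval_mult)
next
  fix a assume "a \<in> range (\<lambda>f. rat_poly_eval f z)"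
  then obtain f where f: "a = rat_poly_eval f z" by blast
  show "- a \<in> range (\<lambda>f. rat_poly_eval f z)"
    using rat_poly_eval_mult[of "[:-1:]" f z] f by (intro range_eqI[of _ _ "[:-1:] * f"]) simp
  assume "a \<noteq> 0"
  then have "\<not> P dvd f" using assms(2) f by (auto simp: rat_poly_eval_mult elim!: dvdE)
  then obtain g h where "g * f + h * P = 1" using irreducible_coprime_or_dvd[OF assms(1)] by blast
  then have "rat_poly_eval (g * f + h * P) z = 1" by simp
  then have "rat_poly_eval g z * a = 1"
    using assms(2) f by (simp add: rat_poly_eval_add rat_poly_eval_mult)
  then show "inverse a \<in> range (\<lambda>f. rat_poly_eval f z)"
    using \<open>a \<noteq> 0\<close> by (intro range_eqI[of _ _ g]) (simp add: field_simps)
qed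

text \<open>The linear functional taking the i-th power of the indeterminate to \<open>t i\<close>.
  With \<open>t\<close> the rational traces of the powers of a root of unity it replaces the field
  trace.\<close>

definition poly_functional :: "(nat \<Rightarrow> rat) \<Rightarrow> rat poly \<Rightarrow> rat" where
  "poly_functional t f = (\<Sum>i\<le>Polynomial.degree f. poly.coeff f i * t i)"

lemma poly_functional_altdef:
  "Polynomial.degree f < n \<Longrightarrow> poly_functional t f = (\<Sum>k<n. poly.coeff f k * t k)"
  unfolding poly_functional_def
  by (rule sum.mono_neutral_cong_left) (auto simp: coeff_eq_0)

lemma poly_functional_add: "poly_functional t (f + g) = poly_functional t f + poly_functional t g"
proof -
  define n where "n = Suc (max (Polynomial.degree f) (Polynomial.degree g))"
  have "Polynomial.degree f < n" "Polynomial.degree g < n" "Polynomial.degree (f + g) < n"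
    using degree_add_le_max[of f g] by (auto simp: n_def)
  then show ?thesis by (simp add: poly_functional_altdef[of _ n] sum.distrib algebra_simps)
qed

lemma poly_functional_0 [simp]: "poly_functional t 0 = 0"
  by (simp add: poly_functional_def)

lemma poly_functional_sum: "poly_functional t (\<Sum>i\<in>A. f i) = (\<Sum>i\<in>A. poly_functional t (f i))"
  by (induction A rule: infinite_finite_induct) (simp_all add: poly_functional_add)

lemma poly_functional_smult: "poly_functional t (Polynomial.smult a f) = a * poly_functional t f"
  by (cases "a = 0") (simp_all add: poly_functional_def sum_distrib_left mult.assoc)

lemma poly_functional_monom: "poly_functional t (Polynomial.monom a n) = a * t n"
proof -
  have "poly_functional t (Polynomial.monom a n) = (\<Sum>k<Suc n. poly.coeff (Polynomial.monom a n) k * t k)"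
    by (rule poly_functional_altdef) (use degree_monom_le[of a n] in simp)
  also have "\<dots> = (\<Sum>k<Suc n. if n = k then a * t n else 0)"
    by (intro sum.cong) auto
  finally show ?thesis by simp
qed

lemma poly_functional_pCons_0: "poly_functional t (pCons 0 f) = poly_functional (\<lambda>i. t (Suc i)) f"
proof -
  have "poly_functional t (pCons 0 f) = (\<Sum>k<Suc (Suc (Polynomial.degree f)). poly.coeff (pCons 0 f) k * t k)"
    by (rule poly_functional_altdef) (use degree_pCons_le[of 0 f] in simp)
  also have "\<dots> = (\<Sum>k<Suc (Polynomial.degree f). poly.coeff f k * t (Suc k))"
    by (subst sum.lessThan_Suc_shift) simp
  also have "\<dots> = poly_functional (\<lambda>i. t (Suc i)) f"
    by (rule poly_functional_altdef[symmetric]) simp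
  finally show ?thesis .
qed

text \<open>Multiplication by the indeterminate shifts the sequence \<open>t\<close>. Hence the
  hypothesis asks for every shift \<open>j\<close>, and the induction on \<open>g\<close> varies
  \<open>t\<close>.\<close>

lemma poly_functional_multiple_eq_0:
  assumes "\<And>j. poly_functional (\<lambda>i. t (j + i)) P = 0"
  shows "poly_functional t (P * g) = 0"
  using assms
proof (induction g arbitrary: t)
  case (pCons a g)
  have "poly_functional t P = 0" using pCons.prems[of 0] by simp
  moreover have "poly_functional (\<lambda>i. t (Suc i)) (P * g) = 0"
    by (rule pCons.IH) (use pCons.prems[of "Suc j" for j] in simp)
  ultimately show ?case
    by (simp add: poly_functional_add poly_functional_smult poly_functional_pCons_0)
qed simp

section \<open>Roots of unity, cyclotomic fields and rational traces\<close>

lemma zeta_power: "zeta m ^ k = cis (2 * pi * real k / real m)"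
  by (simp add: zeta_def DeMoivre mult_ac)

lemma zeta_power_eq_1_iff:
  assumes "m > 0"
  shows "zeta m ^ k = 1 \<longleftrightarrow> m dvd k"
proof
  assume "zeta m ^ k = 1"
  then have "cos (2 * pi * real k / real m) = 1"
    by (simp add: zeta_power complex_eq_iff)
  then obtain n :: int where "2 * pi * real k / real m = of_int n * 2 * pi"
    by (auto simp: cos_one_2pi_int)
  then have "real k = of_int n * real m" using assms by (simp add: field_simps)
  then have "int k = n * int m"
    by (metis of_int_eq_iff of_int_mult of_int_of_nat_eq)
  then show "m dvd k" by (metis dvd_triv_right int_dvd_int_iff)
next
  assume "m dvd k"
  then obtain l where "k = m * l" by blast
  then have "zeta m ^ k = cis (2 * pi * real l)" using assms by (simp add: zeta_power mult_ac)
  then show "zeta m ^ k = 1" by simp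
qed

lemma zeta_power_cong:
  assumes "m > 0" "[i = j] (mod m)"
  shows "zeta m ^ i = zeta m ^ j"
proof -
  have "zeta m ^ i = zeta m ^ (i mod m)" for i
  proof -
    have "zeta m ^ i = (zeta m ^ m) ^ (i div m) * zeta m ^ (i mod m)"
      by (simp flip: power_mult power_add)
    then show ?thesis using assms(1) zeta_power_eq_1_iff[of m m] by simp
  qed
  then show ?thesis using assms(2) unfolding cong_def by metis
qed

lemma subfield_cyclotomic_field: "is_subfield_of_complex (cyclotomic_field m)"
  unfolding cyclotomic_field_def is_subfield_of_complex_def by blast

lemma zeta_in_cyclotomic_field: "zeta m \<in> cyclotomic_field m"
  unfolding cyclotomic_field_def by blast

lemma subfield_power:
  assumes "is_subfield_of_complex K" "z \<in> K"
  shows "z ^ k \<in> K"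
  using assms by (induction k) (auto simp: is_subfield_of_complex_def)

lemma subfield_sum:
  assumes "is_subfield_of_complex K" "\<And>i. i \<in> A \<Longrightarrow> f i \<in> K"
  shows "(\<Sum>i\<in>A. f i) \<in> K"
  using assms(2)
  by (induction A rule: infinite_finite_induct) (use assms(1) in \<open>auto simp: is_subfield_of_complex_def\<close>)

lemma subfield_of_rat:
  assumes K: "is_subfield_of_complex K"
  shows "of_rat q \<in> K"
proof -
  have nat: "of_nat n \<in> K" for n
    by (induction n) (use K in \<open>auto simp: is_subfield_of_complex_def\<close>)
  have int: "of_int i \<in> K" for i
    using nat K by (cases i rule: int_cases2) (auto simp: is_subfield_of_complex_def)
  obtain a b where q: "q = Rat.Fract a b" "b \<noteq> 0" by (metis Rat_cases less_irrefl)
  have "inverse (of_int b) \<in> K" using int K q(2) by (auto simp: is_subfield_of_complex_def)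
  then show ?thesis using int[of a] K q
    by (auto simp: of_rat_rat divide_inverse is_subfield_of_complex_def)
qed

text \<open>\<open>pp_min_poly p M\<close> is the minimal polynomial of \<open>zeta (p ^ M)\<close>, and \<open>ramanujan_pp p M e\<close> is
  the rational trace of \<open>zeta (p ^ M) ^ e\<close>, given by the closed form of the Ramanujan sum.\<close>

definition pp_min_poly :: "nat \<Rightarrow> nat \<Rightarrow> rat poly" where
  "pp_min_poly p M = (if M = 0 then [:-1, 1:] else pp_cyclotomic p (M - 1))"

definition ramanujan_pp :: "nat \<Rightarrow> nat \<Rightarrow> nat \<Rightarrow> int" where
  "ramanujan_pp p M e = (if M = 0 then 1
     else (if p ^ M dvd e then int p ^ M else 0) - (if p ^ (M - 1) dvd e then int p ^ (M - 1) else 0))"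

text \<open>The trace of 1 is the degree of the field; this links the dimension count to the regular
  character.\<close>

lemma int_degree_pp_min_poly:
  assumes "p > 0"
  shows "int (Polynomial.degree (pp_min_poly p M)) = ramanujan_pp p M 0"
  using assms
  by (cases M) (auto simp: pp_min_poly_def ramanujan_pp_def degree_pp_cyclotomic of_nat_diff algebra_simps)

lemma irreducible_pp_min_poly:
  assumes "Factorial_Ring.prime p"
  shows "Factorial_Ring.irreducible (pp_min_poly p M)"
  using assms irreducible_linear_field_poly[of 1 "-1 :: rat"]
  by (simp add: pp_min_poly_def irreducible_pp_cyclotomic_rat)

lemma rat_poly_eval_pp_min_poly:
  assumes "p > 1"
  shows "rat_poly_eval (pp_min_poly p M) (zeta (p ^ M)) = 0"
proof (cases M)
  case 0
  then show ?thesis by (simp add: pp_min_poly_def zeta_def)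
next
  case (Suc k)
  define w where "w = zeta (p ^ M) ^ p ^ k"
  have "w \<noteq> 1"
    unfolding w_def using assms by (subst zeta_power_eq_1_iff) (auto simp: Suc dest!: dvd_imp_le)
  have "w ^ p = 1"
    unfolding w_def using assms by (simp add: Suc zeta_power_eq_1_iff mult.commute flip: power_mult)
  then have "(w - 1) * (\<Sum>c<p. w ^ c) = 0"
    by (simp add: power_diff_1_eq[symmetric])
  then have "(\<Sum>c<p. w ^ c) = 0" using \<open>w \<noteq> 1\<close> by simp
  then show ?thesis
    by (simp add: pp_min_poly_def Suc pp_cyclotomic_def rat_poly_eval_sum poly_monom w_def
        mult.commute flip: power_mult)
qed

text \<open>Division with remainder by the minimal polynomial. The resulting spanning set bounds the
  dimension of the direct sum from above.\<close>

lemma cyclotomic_field_prime_powerE: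
  assumes p: "Factorial_Ring.prime p" and z: "z \<in> cyclotomic_field (p ^ M)"
  obtains a :: "nat \<Rightarrow> rat" where
    "z = (\<Sum>k<Polynomial.degree (pp_min_poly p M). of_rat (a k) * zeta (p ^ M) ^ k)"
proof -
  let ?P = "pp_min_poly p M" and ?z = "zeta (p ^ M)"
  have irr: "Factorial_Ring.irreducible ?P" and root: "rat_poly_eval ?P ?z = 0"
    using p prime_gt_1_nat irreducible_pp_min_poly rat_poly_eval_pp_min_poly by blast+
  have "?z \<in> range (\<lambda>f. rat_poly_eval f ?z)"
    by (rule range_eqI[of _ _ "Polynomial.monom 1 1"]) (simp add: poly_monom)
  then have "cyclotomic_field (p ^ M) \<subseteq> range (\<lambda>f. rat_poly_eval f ?z)"
    unfolding cyclotomic_field_def using subfield_range_rat_poly_eval[OF irr root] by blast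
  then obtain f where f: "z = rat_poly_eval f ?z" using z by blast
  have "rat_poly_eval f ?z = rat_poly_eval (?P * (f div ?P) + f mod ?P) ?z" by simp
  also have "\<dots> = rat_poly_eval (f mod ?P) ?z"
    unfolding rat_poly_eval_add rat_poly_eval_mult root by simp
  finally have "z = rat_poly_eval (f mod ?P) ?z" using f by simp
  \<comment> \<open>Positivity covers the case of remainder 0, whose degree is 0 by
    convention.\<close>
  moreover have "Polynomial.degree ?P > 0"
    using p prime_gt_1_nat[OF p] by (auto simp: pp_min_poly_def degree_pp_cyclotomic)
  then have "Polynomial.degree (f mod ?P) < Polynomial.degree ?P"
    using degree_mod_less' by (metis degree_0 less_numeral_extra(3))
  ultimately show ?thesis using that by (simp add: rat_poly_eval_altdef)
qed

text \<open>Modulo \<open>p\<close> the map taking \<open>c\<close> to \<open>a + c * u\<close>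
  permutes the residues, so exactly one \<open>c\<close> contributes.\<close>

lemma sum_if_prime_dvd_linear:
  fixes x :: "'a :: comm_monoid_add" and p u a :: nat
  assumes p: "Factorial_Ring.prime p" and u: "\<not> p dvd u"
  shows "(\<Sum>c<p. if p dvd a + c * u then x else 0) = x"
proof -
  define f where "f c = (a + c * u) mod p" for c
  have p0: "p > 0" using p prime_gt_0_nat by blast
  have "coprime u p" using prime_imp_coprime[OF p u] by (simp add: ac_simps)
  then have inj: "inj_on f {..<p}"
    by (intro inj_onI)
      (auto simp: f_def cong_def[symmetric] cong_add_lcancel_nat cong_mult_rcancel_nat intro: cong_less_modulus_unique_nat)
  moreover have "f ` {..<p} \<subseteq> {..<p}" using p0 by (auto simp: f_def)
  ultimately have "f ` {..<p} = {..<p}" by (simp add: endo_inj_surj)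
  then have "(\<Sum>c<p. if f c = 0 then x else 0) = (\<Sum>y<p. if y = 0 then x else 0)"
    using sum.reindex[OF inj, of "\<lambda>y. if y = 0 then x else 0"] by simp
  then show ?thesis using p0 by (simp add: f_def dvd_eq_mod_eq_0)
qed

text \<open>A relation is a polynomial vanishing at the root of unity, hence a multiple of its
  minimal polynomial. The trace functional kills such multiples because the Ramanujan sums satisfy
  the recurrence given by the minimal polynomial, from every starting point
  \<open>j\<close>.\<close>

lemma zeta_relation_ramanujan:
  assumes p: "Factorial_Ring.prime p"
    and rel: "(\<Sum>h\<in>S. of_rat (q h) * zeta (p ^ M) ^ e h) = 0"
  shows "(\<Sum>h\<in>S. q h * of_int (ramanujan_pp p M (e h))) = 0"
proof -
  let ?P = "pp_min_poly p M" and ?z = "zeta (p ^ M)"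
  define t :: "nat \<Rightarrow> rat" where "t i = of_int (ramanujan_pp p M i)" for i
  define f where "f = (\<Sum>h\<in>S. Polynomial.monom (q h) (e h))"
  have p1: "p > 1" using p prime_gt_1_nat by blast
  have "rat_poly_eval f ?z = 0"
    using rel by (simp add: f_def rat_poly_eval_sum poly_monom)
  then have "?P dvd f"
    using p p1 irreducible_root_dvd irreducible_pp_min_poly rat_poly_eval_pp_min_poly by blast
  then obtain g where g: "f = ?P * g" by blast
  have "poly_functional (\<lambda>i. t (j + i)) ?P = 0" for j
  proof (cases M)
    case 0
    then show ?thesis by (simp add: pp_min_poly_def poly_functional_def t_def ramanujan_pp_def)
  next
    case (Suc k)
    \<comment> \<open>If \<open>p ^ k\<close> divides \<open>j\<close>, exactly one \<open>c\<close>
      reaches divisibility by \<open>p ^ M\<close> and contributes \<open>p ^ M\<close>, while all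
      \<open>p\<close> values of \<open>c\<close> contribute \<open>p ^ k\<close> to the subtracted
      part. Otherwise both parts vanish.\<close>
    have *: "p ^ k dvd j + c * p ^ k \<longleftrightarrow> p ^ k dvd j" for c by (simp add: dvd_add_left_iff)
    have "(\<Sum>c<p. if p ^ M dvd j + c * p ^ k then (of_nat p ^ M :: rat) else 0) =
      (if p ^ k dvd j then of_nat p ^ M else 0)"
    proof (cases "p ^ k dvd j")
      case True
      then obtain b where b: "j = p ^ k * b" by blast
      have dvd: "p ^ M dvd j + c * p ^ k \<longleftrightarrow> p dvd b + c" for c
      proof -
        have "j + c * p ^ k = p ^ k * (b + c)" by (simp add: b algebra_simps)
        then show ?thesis using p1 by (simp only: Suc power_Suc2) simp
      qed
      show ?thesis
        unfolding dvd using sum_if_prime_dvd_linear[OF p, of 1 b] True p1 by simp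
    next
      case False
      then have "\<not> p ^ M dvd j + c * p ^ k" for c
        using * by (metis Suc power_le_dvd le_SucI order_refl)
      with False show ?thesis by simp
    qed
    moreover have "(\<Sum>c<p. if p ^ k dvd j + c * p ^ k then (of_nat p ^ k :: rat) else 0) =
      (if p ^ k dvd j then of_nat p ^ M else 0)"
      unfolding * by (simp add: Suc)
    ultimately have "(\<Sum>c<p. t (j + c * p ^ k)) = 0"
      by (simp add: t_def ramanujan_pp_def Suc sum_subtractf of_int_diff if_distrib[of of_int] cong: if_cong)
    then show ?thesis
      by (simp add: pp_min_poly_def Suc pp_cyclotomic_def poly_functional_sum poly_functional_monom)
  qed
  from poly_functional_multiple_eq_0[of t ?P g, OF this]
  have "poly_functional t f = 0" by (simp add: g)
  then show ?thesis by (simp add: f_def poly_functional_sum poly_functional_monom t_def)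
qed

section \<open>The regular character\<close>

text \<open>A parameter \<open>(r, M, s, t)\<close> stands for the irreducible representation of degree \<open>p ^ r\<close> over
  \<open>\<rat>(\<zeta>_(p ^ M))\<close> in which \<open>x ^ p ^ r\<close> is the scalar \<open>\<zeta>_p ^ s\<close> and \<open>y ^ p ^ r\<close> is the scalar
  \<open>\<zeta>_(p ^ M) ^ t\<close>.  For \<open>M = 0\<close> the truncated \<open>p ^ (M - 1)\<close> is harmless because \<open>s = 0\<close>.\<close>

type_synonym rep_param = "nat \<times> nat \<times> nat \<times> nat"

text \<open>For 0 < r <= n the pair (\<open>s\<close>, \<open>t\<close>) encodes a character of C_p
  x C_(p^(n-r)), generated by the images of x^(p^r) and y^(p^r), that is nontrivial on the first
  factor. The list picks one from each Galois orbit: in order p the first value is made zeta_p, in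
  order p^m with m >= 2 the second is made zeta_(p^m). Level r = 0 also contains the characters
  trivial on x.\<close>

definition rep_params :: "nat \<Rightarrow> nat \<Rightarrow> rep_param list" where
  "rep_params p n =
     [(0, 0, 0, 0)]
     @ ((0, 1, 0, 1) # map (\<lambda>t. (0, 1, 1, t)) [0..<p])
     @ concat (map (\<lambda>m. map (\<lambda>s. (0, m, s, 1)) [0..<p]) [2..<n + 1])
     @ concat (map (\<lambda>r. map (\<lambda>t. (r, 1, 1, t)) [0..<p]) [1..<n])
     @ concat (map (\<lambda>r. concat (map (\<lambda>m. map (\<lambda>s. (r, m, s, 1)) [1..<p]) [2..<n - r + 1]))
                   [1..<n - 1])
     @ [(n, 1, 1, 0)]"

fun rep_block :: "nat \<Rightarrow> rep_param \<Rightarrow> nat \<times> nat" where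
  "rep_block p (r, m, s, t) = (p ^ r, p ^ m)"

lemma map_rep_block_rep_params: "map (rep_block p) (rep_params p n) = thm54_blocks p n"
  by (simp add: rep_params_def thm54_blocks_def map_concat o_def map_replicate_const)

text \<open>The exponent of zeta_(p^m) in the scalar by which y^j x^i acts. It has this meaning only
  when \<open>p ^ r\<close> divides both \<open>i\<close> and \<open>j\<close>, the condition that
  guards its uses.\<close>

fun rep_exponent :: "nat \<Rightarrow> rep_param \<Rightarrow> nat \<Rightarrow> nat \<Rightarrow> nat" where
  "rep_exponent p (r, m, s, t) i j = s * p ^ (m - 1) * (i div p ^ r) + t * (j div p ^ r)"

text \<open>Degree times rational trace of the character: one factor \<open>p ^ r\<close> is the
  degree, the other comes from the trace of a scalar matrix.\<close>

fun rep_weight :: "nat \<Rightarrow> rep_param \<Rightarrow> nat \<Rightarrow> nat \<Rightarrow> int" where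
  "rep_weight p (r, m, s, t) i j =
     (if p ^ r dvd i \<and> p ^ r dvd j
      then int p ^ (2 * r) * ramanujan_pp p m (rep_exponent p (r, m, s, t) i j) else 0)"

section \<open>Summing the weighted rational traces\<close>

context
  fixes p :: nat
  assumes p: "Factorial_Ring.prime p"
begin

text \<open>The regular character of the cyclic group of order \<open>p ^ k\<close> at
  \<open>e\<close>. Ramanujan sums are differences of consecutive values, which makes everything
  telescope.\<close>

definition dvd_power_weight :: "nat \<Rightarrow> nat \<Rightarrow> int" where
  "dvd_power_weight k e = (if p ^ k dvd e then int p ^ k else 0)"

lemma ramanujan_pp_Suc:
  "ramanujan_pp p (Suc k) e = dvd_power_weight (Suc k) e - dvd_power_weight k e"
  by (simp add: ramanujan_pp_def dvd_power_weight_def)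

lemma sum_ramanujan_pp_telescope:
  "N \<ge> 1 \<Longrightarrow> (\<Sum>m=2..<N + 1. ramanujan_pp p m e) = dvd_power_weight N e - dvd_power_weight 1 e"
proof (induction N rule: dec_induct)
  case (step N)
  then have "{2..<Suc N + 1} = insert (Suc N) {2..<N + 1}" by auto
  then show ?case using step by (simp add: ramanujan_pp_Suc)
qed simp

text \<open>If \<open>p\<close> divides \<open>b\<close>, all terms equal the one at
  \<open>a\<close>. Otherwise exactly one \<open>t\<close> contributes \<open>p\<close>, cancelling
  the \<open>p\<close> subtracted ones.\<close>

lemma sum_ramanujan_pp_1:
  "(\<Sum>t=0..<p. ramanujan_pp p 1 (a + t * b)) = (dvd_power_weight 1 a - 1) * dvd_power_weight 1 b"
proof -
  have "(\<Sum>t<p. dvd_power_weight 1 (a + t * b)) =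
      (if p dvd b then int p * dvd_power_weight 1 a else int p)"
    using sum_if_prime_dvd_linear[OF p, of b a "int p"]
    by (auto simp: dvd_power_weight_def dvd_add_left_iff cong: if_cong)
  moreover have "(\<Sum>t=0..<p. ramanujan_pp p 1 (a + t * b)) = (\<Sum>t<p. dvd_power_weight 1 (a + t * b)) - int p"
    using ramanujan_pp_Suc[of 0] by (simp add: sum_subtractf atLeast0LessThan dvd_power_weight_def[of 0])
  ultimately show ?thesis by (auto simp: dvd_power_weight_def algebra_simps)
qed

text \<open>If \<open>p\<close> divides \<open>a\<close>, the shift is a multiple of
  \<open>p ^ m\<close> and is invisible. Otherwise, for \<open>p ^ (m - 1)\<close> dividing
  \<open>b\<close>, exactly one \<open>s\<close> contributes \<open>p ^ m\<close>, which the
  \<open>p\<close> subtracted terms cancel; for other \<open>b\<close> all terms vanish.\<close>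

lemma sum_ramanujan_pp_shift:
  assumes "m \<ge> 2"
  shows "(\<Sum>s=0..<p. ramanujan_pp p m (s * p ^ (m - 1) * a + b)) = dvd_power_weight 1 a * ramanujan_pp p m b"
proof -
  obtain k where m: "m = Suc k" using assms by (cases m) auto
  have p0: "p > 0" using p prime_gt_0_nat by blast
  have k: "dvd_power_weight k (s * p ^ k * a + b) = dvd_power_weight k b" for s
    by (simp add: dvd_power_weight_def dvd_add_right_iff)
  have "(\<Sum>s<p. dvd_power_weight m (s * p ^ k * a + b)) =
     (if p dvd a then int p * dvd_power_weight m b else if p ^ k dvd b then int p ^ m else 0)"
  proof (cases "p dvd a")
    case True
    then have "p ^ m dvd s * p ^ k * a" for s by (auto simp: m mult_ac)
    then have "dvd_power_weight m (s * p ^ k * a + b) = dvd_power_weight m b" for s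
      by (simp add: dvd_power_weight_def dvd_add_right_iff)
    with True show ?thesis by simp
  next
    case a: False
    show ?thesis
    proof (cases "p ^ k dvd b")
      case True
      then obtain c where c: "b = p ^ k * c" by blast
      have "p ^ m dvd s * p ^ k * a + b \<longleftrightarrow> p dvd c + s * a" for s
      proof -
        have "s * p ^ k * a + b = p ^ k * (c + s * a)" by (simp add: c algebra_simps)
        then show ?thesis using p0 by (simp only: m power_Suc2) simp
      qed
      then show ?thesis
        using a True sum_if_prime_dvd_linear[OF p, of a c "int p ^ m"] by (simp add: dvd_power_weight_def)
    next
      case False
      then have "\<not> p ^ k dvd s * p ^ k * a + b" for s by (simp add: dvd_add_right_iff)
      then have "\<not> p ^ m dvd s * p ^ k * a + b" for s
        by (metis m power_le_dvd le_SucI order_refl)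
      with a False show ?thesis by (simp add: dvd_power_weight_def)
    qed
  qed
  moreover have "(\<Sum>s=0..<p. ramanujan_pp p m (s * p ^ (m - 1) * a + b)) =
     (\<Sum>s<p. dvd_power_weight m (s * p ^ k * a + b)) - int p * dvd_power_weight k b"
    by (simp add: m ramanujan_pp_Suc sum_subtractf atLeast0LessThan k)
  ultimately show ?thesis
    by (auto simp: m ramanujan_pp_Suc) (auto simp: dvd_power_weight_def algebra_simps)
qed

lemma sum_ramanujan_pp_shift_nonzero:
  assumes "m \<ge> 2"
  shows "(\<Sum>s=1..<p. ramanujan_pp p m (s * p ^ (m - 1) * a + b)) =
    (dvd_power_weight 1 a - 1) * ramanujan_pp p m b"
proof -
  have "p > 0" using p prime_gt_0_nat by blast
  then show ?thesis
    using sum_ramanujan_pp_shift[OF assms, of a b]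
    by (simp add: sum.atLeast_Suc_lessThan left_diff_distrib)
qed

lemma dvd_power_weight_div:
  assumes "k \<le> l"
  shows "(if p ^ k dvd e then int p ^ k * dvd_power_weight (l - k) (e div p ^ k) else 0) = dvd_power_weight l e"
proof -
  have "p ^ l = p ^ k * p ^ (l - k)" using assms by (simp flip: power_add)
  moreover have "p > 0" using p prime_gt_0_nat by blast
  ultimately have "p ^ l dvd e \<longleftrightarrow> p ^ k dvd e \<and> p ^ (l - k) dvd e div p ^ k"
    by (auto elim!: dvdE)
  then show ?thesis using assms by (auto simp: dvd_power_weight_def simp flip: power_add)
qed

text \<open>Summing over \<open>s\<close>, \<open>t\<close> and \<open>m\<close> leaves, at each
  level r >= 1, a difference of consecutive weights in \<open>i\<close> times the weight of level
  \<open>n\<close> in \<open>j\<close>. These telescope over \<open>r\<close>. Level 0 supplies the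
  starting value, and the result is the order of the group times the indicator of the
  identity.\<close>

lemma sum_rep_weight:
  assumes n: "n \<ge> 1"
  shows "sum_list (map (\<lambda>q. rep_weight p q i j) (rep_params p n)) =
    (if p ^ (n + 1) dvd i \<and> p ^ n dvd j then int p ^ (2 * n + 1) else 0)"
proof -
  define W where "W r = (if p ^ r dvd i \<and> p ^ r dvd j then int p ^ (2 * r) else 0)" for r
  define A where "A r = dvd_power_weight 1 (i div p ^ r)" for r
  define B where "B r k = dvd_power_weight k (j div p ^ r)" for r k
  have w: "rep_weight p (r, m, s, t) i j =
    W r * ramanujan_pp p m (s * p ^ (m - 1) * (i div p ^ r) + t * (j div p ^ r))" for r m s t
    by (simp add: W_def)
  have W0: "W 0 = 1" by (simp add: W_def)
  have B0: "B r 0 = 1" for r by (simp add: B_def dvd_power_weight_def)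
  have ram1: "ramanujan_pp p 1 e = dvd_power_weight 1 e - 1" for e
    using ramanujan_pp_Suc[of 0 e] by (simp add: dvd_power_weight_def[of 0])
  have S1: "(\<Sum>t=0..<p. rep_weight p (r, 1, 1, t) i j) = W r * ((A r - 1) * B r 1)" for r
    unfolding w sum_distrib_left[symmetric] A_def B_def sum_ramanujan_pp_1[symmetric] by simp
  have S2: "(\<Sum>m=2..<n + 1. \<Sum>s=0..<p. rep_weight p (0, m, s, 1) i j) = A 0 * (B 0 n - B 0 1)"
  proof -
    have "(\<Sum>m=2..<n + 1. \<Sum>s=0..<p. rep_weight p (0, m, s, 1) i j) =
        (\<Sum>m=2..<n + 1. A 0 * ramanujan_pp p m (j div p ^ 0))"
    proof (intro sum.cong refl)
      fix m assume "m \<in> {2..<n + 1}"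
      then show "(\<Sum>s=0..<p. rep_weight p (0, m, s, 1) i j) = A 0 * ramanujan_pp p m (j div p ^ 0)"
        using sum_ramanujan_pp_shift[of m "i div p ^ 0" "j div p ^ 0"] unfolding w W0 A_def by simp
    qed
    then show ?thesis
      unfolding sum_distrib_left[symmetric] sum_ramanujan_pp_telescope[OF n] B_def by simp
  qed
  have S3: "(\<Sum>m=2..<n - r + 1. \<Sum>s=1..<p. rep_weight p (r, m, s, 1) i j) =
      W r * ((A r - 1) * (B r (n - r) - B r 1))" if "n - r \<ge> 1" for r
  proof -
    have "(\<Sum>m=2..<n - r + 1. \<Sum>s=1..<p. rep_weight p (r, m, s, 1) i j) =
        (\<Sum>m=2..<n - r + 1. W r * ((A r - 1) * ramanujan_pp p m (j div p ^ r)))"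
    proof (intro sum.cong refl)
      fix m assume "m \<in> {2..<n - r + 1}"
      then show "(\<Sum>s=1..<p. rep_weight p (r, m, s, 1) i j) = W r * ((A r - 1) * ramanujan_pp p m (j div p ^ r))"
        using sum_ramanujan_pp_shift_nonzero[of m "i div p ^ r" "j div p ^ r"]
        unfolding w sum_distrib_left[symmetric] A_def by simp
    qed
    then show ?thesis
      unfolding sum_distrib_left[symmetric] sum_ramanujan_pp_telescope[OF that] B_def by simp
  qed
  \<comment> \<open>The factor p^(2r) in \<open>W r\<close> is split evenly: one p^r turns the
    weights of \<open>i div p ^ r\<close> into weights of \<open>i\<close>, the other does the same
    for \<open>j\<close>.\<close>
  have T: "W r * ((A r - 1) * B r (n - r)) =
      (dvd_power_weight (Suc r) i - dvd_power_weight r i) * dvd_power_weight n j" if "r \<le> n" for r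
  proof -
    have "dvd_power_weight n j = (if p ^ r dvd j then int p ^ r * B r (n - r) else 0)"
      using dvd_power_weight_div[of r n j, symmetric] that by (simp only: B_def)
    moreover have "dvd_power_weight (Suc r) i = (if p ^ r dvd i then int p ^ r * A r else 0)"
      using dvd_power_weight_div[of r "Suc r" i, symmetric] by (simp add: A_def)
    moreover have "dvd_power_weight r i = (if p ^ r dvd i then int p ^ r else 0)"
      by (simp add: dvd_power_weight_def)
    ultimately show ?thesis
      by (simp add: W_def power_mult power_mult_distrib power2_eq_square mult_2 power_add algebra_simps
          del: power_mult_numeral)
  qed
  \<comment> \<open>Adding r = n - 1 changes nothing, since the range of \<open>m\<close> is then
    empty; it aligns the range with that of the blocks over Q(zeta_p).\<close>
  have "(\<Sum>r=1..<n - 1. \<Sum>m=2..<n - r + 1. \<Sum>s=1..<p. rep_weight p (r, m, s, 1) i j) =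
     (\<Sum>r=1..<n. \<Sum>m=2..<n - r + 1. \<Sum>s=1..<p. rep_weight p (r, m, s, 1) i j)"
  proof (rule sum.mono_neutral_left)
    show "\<forall>r\<in>{1..<n} - {1..<n - 1}. (\<Sum>m=2..<n - r + 1. \<Sum>s=1..<p. rep_weight p (r, m, s, 1) i j) = 0"
    proof
      fix r assume "r \<in> {1..<n} - {1..<n - 1}"
      then have "n - r + 1 = 2" by auto
      then show "(\<Sum>m=2..<n - r + 1. \<Sum>s=1..<p. rep_weight p (r, m, s, 1) i j) = 0"
        by (simp only: atLeastLessThan_empty[OF order.refl] sum.empty)
    qed
  qed auto
  also have "\<dots> = (\<Sum>r=1..<n. W r * ((A r - 1) * (B r (n - r) - B r 1)))"
    by (intro sum.cong refl S3) auto
  finally have S4: "(\<Sum>r=1..<n - 1. \<Sum>m=2..<n - r + 1. \<Sum>s=1..<p. rep_weight p (r, m, s, 1) i j) = \<dots>" .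
  have "sum_list (map (\<lambda>q. rep_weight p q i j) (rep_params p n)) =
     rep_weight p (0, 0, 0, 0) i j + rep_weight p (0, 1, 0, 1) i j +
      (\<Sum>t=0..<p. rep_weight p (0, 1, 1, t) i j) +
      (\<Sum>m=2..<n + 1. \<Sum>s=0..<p. rep_weight p (0, m, s, 1) i j) +
      (\<Sum>r=1..<n. \<Sum>t=0..<p. rep_weight p (r, 1, 1, t) i j) +
      (\<Sum>r=1..<n - 1. \<Sum>m=2..<n - r + 1. \<Sum>s=1..<p. rep_weight p (r, m, s, 1) i j) +
      rep_weight p (n, 1, 1, 0) i j"
    unfolding rep_params_def
    by (simp only: map_append sum_list_append map_concat sum_list_concat map_map o_def list.map
        sum_list.Cons sum_list.Nil interv_sum_list_conv_sum_set_nat set_upt add_0_right add_0_left add.assoc)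
  \<comment> \<open>The trivial character contributes 1, which fills in the -1 of the Ramanujan
    sum.\<close>
  also have "rep_weight p (0, 0, 0, 0) i j + rep_weight p (0, 1, 0, 1) i j = B 0 1"
    by (simp add: ramanujan_pp_def[of p 0] ram1[unfolded One_nat_def] B_def)
  \<comment> \<open>Writing the factor 1 as \<open>B n (n - n)\<close> makes the last block the term
    r = n of the common sum.\<close>
  also have "rep_weight p (n, 1, 1, 0) i j = W n * ((A n - 1) * B n (n - n))"
    unfolding w by (simp add: ram1[unfolded One_nat_def] B0 A_def)
  also have "B 0 1 + (\<Sum>t=0..<p. rep_weight p (0, 1, 1, t) i j) +
      (\<Sum>m=2..<n + 1. \<Sum>s=0..<p. rep_weight p (0, m, s, 1) i j) = A 0 * B 0 n"
    unfolding S1 S2 W0 by (simp add: algebra_simps)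
  also have "A 0 * B 0 n + (\<Sum>r=1..<n. \<Sum>t=0..<p. rep_weight p (r, 1, 1, t) i j) +
      (\<Sum>r=1..<n - 1. \<Sum>m=2..<n - r + 1. \<Sum>s=1..<p. rep_weight p (r, m, s, 1) i j) +
      W n * ((A n - 1) * B n (n - n)) =
      A 0 * B 0 n + ((\<Sum>r=1..<n. W r * ((A r - 1) * B r (n - r))) + W n * ((A n - 1) * B n (n - n)))"
    unfolding S1 S4 by (simp add: algebra_simps flip: sum.distrib)
  also have "(\<Sum>r=1..<n. W r * ((A r - 1) * B r (n - r))) + W n * ((A n - 1) * B n (n - n)) =
      (\<Sum>r=1..<Suc n. W r * ((A r - 1) * B r (n - r)))"
    using n by simp
  also have "\<dots> = (\<Sum>r=1..<Suc n. dvd_power_weight (Suc r) i - dvd_power_weight r i) * dvd_power_weight n j"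
    unfolding sum_distrib_right by (intro sum.cong refl T) auto
  also have "(\<Sum>r=1..<Suc n. dvd_power_weight (Suc r) i - dvd_power_weight r i) =
      dvd_power_weight (Suc n) i - dvd_power_weight 1 i"
    using sum_Suc_diff'[of 1 "Suc n" "\<lambda>r. dvd_power_weight r i"] n by simp
  also have "A 0 * B 0 n + (dvd_power_weight (Suc n) i - dvd_power_weight 1 i) * dvd_power_weight n j =
      dvd_power_weight (Suc n) i * dvd_power_weight n j"
    by (simp add: A_def B_def algebra_simps)
  also have "\<dots> = (if p ^ (n + 1) dvd i \<and> p ^ n dvd j then int p ^ (2 * n + 1) else 0)"
    by (simp add: dvd_power_weight_def mult_2 power_add)
  finally show ?thesis .
qed

end

section \<open>Monomial representations\<close>

lemma mult_mat_unit_vec: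
  fixes A :: "'a :: semiring_1 mat"
  assumes "A \<in> carrier_mat n m" "j < m"
  shows "A *\<^sub>v unit_vec m j = col A j"
  using assms by (intro eq_vecI) auto

lemma smult_one_mat_mult_vec:
  fixes k :: "'a :: comm_ring_1"
  assumes "v \<in> carrier_vec n"
  shows "(k \<cdot>\<^sub>m 1\<^sub>m n) *\<^sub>v v = k \<cdot>\<^sub>v v"
proof (rule eq_vecI)
  fix i assume i: "i < dim_vec (k \<cdot>\<^sub>v v)"
  then have "row (k \<cdot>\<^sub>m 1\<^sub>m n) i = k \<cdot>\<^sub>v unit_vec n i"
    using assms by (intro eq_vecI) (auto simp: unit_vec_def)
  then show "((k \<cdot>\<^sub>m 1\<^sub>m n) *\<^sub>v v) $ i = (k \<cdot>\<^sub>v v) $ i"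
    using i assms by (simp add: scalar_prod_left_unit)
qed (use assms in auto)

text \<open>The representation is induced from a linear character with values in \<open>\<langle>z\<rangle>\<close>: if \<open>v\<close> spans the
  inducing line, \<open>bvec l (c * k)\<close> plays the role of \<open>y ^ l x ^ k v\<close>, where \<open>p ^ a\<close> steps in the second argument
  multiply by \<open>z\<close>, and \<open>p ^ d\<close> steps in the first one act on the second by \<open>e \<mapsto> u * e + t\<close>.  The
  split \<open>r = a + d\<close> is chosen so that the powers of \<open>z\<close> contain all the scalars that occur.\<close>

locale monomial_rep =
  fixes p a d M c u t s :: nat
  assumes prime_p: "Factorial_Ring.prime p" and odd_p: "odd p"
    and u_cong: "[u = 1] (mod p ^ M)"
    and wrap_cong: "[u * (c * (1 + p) ^ p ^ d) = c] (mod p ^ (a + M))"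
    and c_cong: "[p ^ d * c = s * p ^ (M - 1)] (mod p ^ M)"
begin

abbreviation "z \<equiv> zeta (p ^ M)"
abbreviation "rsize \<equiv> p ^ (a + d)"

lemma p_pos: "p > 0"
  using prime_p prime_gt_0_nat by blast

definition bvec :: "nat \<Rightarrow> nat \<Rightarrow> complex vec" where
  "bvec l e = z ^ (e div p ^ a) \<cdot>\<^sub>v unit_vec rsize (l * p ^ a + e mod p ^ a)"

lemma bvec_carrier [simp]: "bvec l e \<in> carrier_vec rsize" "dim_vec (bvec l e) = rsize"
  by (simp_all add: bvec_def)

lemma z_power_cong: "[i = j] (mod p ^ M) \<Longrightarrow> z ^ i = z ^ j"
  by (rule zeta_power_cong) (use p_pos in auto)

text \<open>There are \<open>p ^ a\<close> positions and \<open>p ^ M\<close> powers of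
  \<open>z\<close>, so the second argument lives modulo \<open>p ^ (a + M)\<close>. Identities
  between matrices thereby become congruences between exponents.\<close>

lemma bvec_cong:
  assumes "[e = e'] (mod p ^ (a + M))"
  shows "bvec l e = bvec l e'"
proof -
  have *: "e mod p ^ a = e mod p ^ (a + M) mod p ^ a"
    "e div p ^ a mod p ^ M = e mod p ^ (a + M) div p ^ a" for e
    using p_pos by (simp_all add: power_add mod_mult2_eq)
  have "e mod p ^ a = e' mod p ^ a" "[e div p ^ a = e' div p ^ a] (mod p ^ M)"
    using assms *[of e] *[of e'] by (simp_all add: cong_def)
  then show ?thesis by (simp add: bvec_def z_power_cong)
qed

lemma bvec_shift: "bvec l (e + p ^ a * q) = z ^ q \<cdot>\<^sub>v bvec l e"
  using p_pos by (simp add: bvec_def smult_smult_assoc power_add mult.commute)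

lemma unit_vec_bvec: "unit_vec rsize j = bvec (j div p ^ a) (j mod p ^ a)"
proof -
  have "j mod p ^ a div p ^ a = 0" using p_pos by simp
  then show ?thesis by (simp only: bvec_def mod_mod_trivial div_mult_mod_eq power_0 one_smult_vec)
qed

definition of_cols :: "(nat \<Rightarrow> complex vec) \<Rightarrow> complex mat" where
  "of_cols v = mat rsize rsize (\<lambda>(i, j). v j $ i)"

lemma of_cols_carrier [simp]: "of_cols v \<in> carrier_mat rsize rsize"
  by (simp add: of_cols_def)

lemma of_cols_mult_bvec:
  assumes "l < p ^ d" "\<And>j. v j \<in> carrier_vec rsize"
  shows "of_cols v *\<^sub>v bvec l e = z ^ (e div p ^ a) \<cdot>\<^sub>v v (l * p ^ a + e mod p ^ a)"
proof -
  have "l * p ^ a + e mod p ^ a < (l + 1) * p ^ a" using p_pos by simp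
  also have "\<dots> \<le> p ^ d * p ^ a" using assms(1) by (intro mult_right_mono) auto
  finally have less: "l * p ^ a + e mod p ^ a < rsize" by (simp add: power_add mult.commute)
  have "of_cols v *\<^sub>v bvec l e = z ^ (e div p ^ a) \<cdot>\<^sub>v col (of_cols v) (l * p ^ a + e mod p ^ a)"
    unfolding bvec_def using less
    by (subst mult_mat_vec[OF of_cols_carrier]) (auto simp: mult_mat_unit_vec[OF of_cols_carrier])
  also have "col (of_cols v) (l * p ^ a + e mod p ^ a) = v (l * p ^ a + e mod p ^ a)"
    using less assms(2)[of "l * p ^ a + e mod p ^ a"] by (auto simp: of_cols_def)
  finally show ?thesis .
qed

lemma eq_on_bvec:
  assumes "A \<in> carrier_mat rsize rsize" "B \<in> carrier_mat rsize rsize"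
    and "\<And>l e. l < p ^ d \<Longrightarrow> A *\<^sub>v bvec l e = B *\<^sub>v bvec l e"
  shows "A = B"
proof (rule eq_matI)
  fix i j assume ij: "i < dim_row B" "j < dim_col B"
  then have j: "j < rsize" using assms(2) by auto
  then have "j div p ^ a < p ^ d" using p_pos by (simp add: power_add less_mult_imp_div_less mult.commute)
  from assms(3)[OF this, of "j mod p ^ a"] have "col A j = col B j"
    unfolding unit_vec_bvec[symmetric] using assms(1,2) j by (simp add: mult_mat_unit_vec)
  then show "A $$ (i, j) = B $$ (i, j)"
    using ij assms(1,2) by (metis carrier_matD index_col)
qed (use assms in auto)

definition "xmat = of_cols (\<lambda>j. bvec (j div p ^ a) (j mod p ^ a + c * (1 + p) ^ (j div p ^ a)))"

definition "ymat = of_cols (\<lambda>j. if j div p ^ a + 1 < p ^ d then bvec (j div p ^ a + 1) (j mod p ^ a)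
   else bvec 0 (u * (j mod p ^ a) + t))"

lemma xmat_carrier [simp]: "xmat \<in> carrier_mat rsize rsize" and ymat_carrier [simp]: "ymat \<in> carrier_mat rsize rsize"
  by (simp_all add: xmat_def ymat_def)

lemma dim_xmat_ymat [simp]:
  "dim_row xmat = rsize" "dim_col xmat = rsize" "dim_row ymat = rsize" "dim_col ymat = rsize"
  by (simp_all add: xmat_def ymat_def of_cols_def)

lemma xmat_bvec:
  assumes "l < p ^ d"
  shows "xmat *\<^sub>v bvec l e = bvec l (e + c * (1 + p) ^ l)"
proof -
  have "xmat *\<^sub>v bvec l e = bvec l (e mod p ^ a + c * (1 + p) ^ l + p ^ a * (e div p ^ a))"
    unfolding xmat_def bvec_shift using assms p_pos by (subst of_cols_mult_bvec) auto
  also have "e mod p ^ a + c * (1 + p) ^ l + p ^ a * (e div p ^ a) = e + c * (1 + p) ^ l"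
    by (metis add.assoc add.commute mod_mult_div_eq)
  finally show ?thesis .
qed

lemma ymat_bvec_Suc:
  assumes "l + 1 < p ^ d"
  shows "ymat *\<^sub>v bvec l e = bvec (l + 1) e"
proof -
  have "ymat *\<^sub>v bvec l e = bvec (l + 1) (e mod p ^ a + p ^ a * (e div p ^ a))"
    unfolding ymat_def bvec_shift using assms p_pos by (subst of_cols_mult_bvec) auto
  then show ?thesis by simp
qed

text \<open>As \<open>u\<close> is 1 modulo \<open>p ^ M\<close>, shifting by \<open>p ^ a\<close>
  before or after the affine map gives the same factor \<open>z\<close>. Linearity of
  \<open>ymat\<close> is compatible with the formula for this reason.\<close>

lemma ymat_bvec_wrap:
  assumes "l + 1 = p ^ d"
  shows "ymat *\<^sub>v bvec l e = bvec 0 (u * e + t)"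
proof -
  have "ymat *\<^sub>v bvec l e = bvec 0 (u * (e mod p ^ a) + t + p ^ a * (e div p ^ a))"
    unfolding ymat_def bvec_shift using assms p_pos by (subst of_cols_mult_bvec) auto
  also have "\<dots> = bvec 0 (u * e + t)"
  proof (rule bvec_cong)
    have "[p ^ a * 1 = p ^ a * u] (mod p ^ (a + M))"
      unfolding power_add by (rule cong_cmult_leftI[OF cong_sym[OF u_cong]])
    then have "[u * (e mod p ^ a) + t + p ^ a * 1 * (e div p ^ a) =
        u * (e mod p ^ a) + t + p ^ a * u * (e div p ^ a)] (mod p ^ (a + M))"
      by (rule cong_add[OF cong_refl cong_mult[OF _ cong_refl]])
    also have "u * (e mod p ^ a) + t + p ^ a * u * (e div p ^ a) = u * (e mod p ^ a + p ^ a * (e div p ^ a)) + t"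
      by (simp only: algebra_simps)
    finally show "[u * (e mod p ^ a) + t + p ^ a * (e div p ^ a) = u * e + t] (mod p ^ (a + M))"
      by simp
  qed
  finally show ?thesis .
qed

lemma pow_mat_Suc_vec:
  assumes "A \<in> carrier_mat rsize rsize" "v \<in> carrier_vec rsize"
  shows "A ^\<^sub>m (Suc k) *\<^sub>v v = A ^\<^sub>m k *\<^sub>v (A *\<^sub>v v)"
  using assms by (simp add: assoc_mult_mat_vec[of _ rsize rsize _ rsize])

lemma pow_mat_add_vec:
  assumes A: "A \<in> carrier_mat rsize rsize" and v: "v \<in> carrier_vec rsize"
  shows "A ^\<^sub>m (k + l) *\<^sub>v v = A ^\<^sub>m k *\<^sub>v (A ^\<^sub>m l *\<^sub>v v)"
  using v
proof (induction l arbitrary: v)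
  case (Suc l)
  then have "A *\<^sub>v v \<in> carrier_vec rsize" using A by simp
  then show ?case using Suc A by (simp only: add_Suc_right pow_mat_Suc_vec)
qed (use A in auto)

lemma xmat_pow_bvec:
  assumes "l < p ^ d"
  shows "xmat ^\<^sub>m k *\<^sub>v bvec l e = bvec l (e + k * (c * (1 + p) ^ l))"
proof (induction k arbitrary: e)
  case (Suc k)
  then show ?case
    by (simp only: pow_mat_Suc_vec[OF xmat_carrier bvec_carrier(1)] xmat_bvec[OF assms])
      (simp add: algebra_simps)
qed simp

lemma ymat_pow_bvec_less:
  "l + k < p ^ d \<Longrightarrow> ymat ^\<^sub>m k *\<^sub>v bvec l e = bvec (l + k) e"
proof (induction k arbitrary: l)
  case (Suc k)
  then show ?case
    using Suc.IH[of "l + 1"]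
    by (simp add: pow_mat_Suc_vec[OF ymat_carrier bvec_carrier(1)] ymat_bvec_Suc del: pow_mat.simps)
qed simp

lemma ymat_pow_bvec_full:
  assumes "l < p ^ d"
  shows "ymat ^\<^sub>m (p ^ d) *\<^sub>v bvec l e = bvec l (u * e + t)"
proof -
  \<comment> \<open>The path climbs \<open>m\<close> layers to the last one, wraps once, and climbs
    \<open>l\<close> layers back to the start, so the affine map is applied exactly once.\<close>
  define m where "m = p ^ d - 1 - l"
  have pd: "p ^ d = l + Suc m" and m: "l + m + 1 = p ^ d" using assms by (auto simp: m_def)
  have "ymat ^\<^sub>m (l + Suc m) *\<^sub>v bvec l e = ymat ^\<^sub>m l *\<^sub>v (ymat *\<^sub>v (ymat ^\<^sub>m m *\<^sub>v bvec l e))"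
    using pow_mat_add_vec[OF ymat_carrier bvec_carrier(1), of l "1 + m"]
      pow_mat_add_vec[OF ymat_carrier bvec_carrier(1), of 1 m] by simp
  also have "ymat ^\<^sub>m m *\<^sub>v bvec l e = bvec (l + m) e"
    by (rule ymat_pow_bvec_less) (use m in simp)
  also have "ymat *\<^sub>v \<dots> = bvec 0 (u * e + t)"
    by (rule ymat_bvec_wrap) (use m in simp)
  also have "ymat ^\<^sub>m l *\<^sub>v \<dots> = bvec l (u * e + t)"
    using ymat_pow_bvec_less[of 0 l] assms by simp
  finally show ?thesis using pd by simp
qed

lemma ymat_pow_bvec_multiple:
  assumes "l < p ^ d"
  shows "ymat ^\<^sub>m (p ^ d * q) *\<^sub>v bvec l e = bvec l (u ^ q * e + t * (\<Sum>i<q. u ^ i))"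
proof (induction q)
  case (Suc q)
  have "ymat ^\<^sub>m (p ^ d * Suc q) *\<^sub>v bvec l e = ymat ^\<^sub>m (p ^ d) *\<^sub>v (ymat ^\<^sub>m (p ^ d * q) *\<^sub>v bvec l e)"
    using pow_mat_add_vec[OF ymat_carrier bvec_carrier(1), of "p ^ d" "p ^ d * q"] by simp
  also have "\<dots> = bvec l (u * (u ^ q * e + t * (\<Sum>i<q. u ^ i)) + t)"
    unfolding Suc by (rule ymat_pow_bvec_full[OF assms])
  also have "u * (u ^ q * e + t * (\<Sum>i<q. u ^ i)) + t = u ^ Suc q * e + t * (\<Sum>i<Suc q. u ^ i)"
    by (subst sum.lessThan_Suc_shift) (simp add: algebra_simps sum_distrib_left)
  finally show ?case .
qed simp

text \<open>Passing from layer \<open>l\<close> to the next, both sides shift by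
  \<open>c * (1 + p) ^ Suc l\<close>, by the choice of the shifts in \<open>xmat\<close>. Only the
  wrap from the last layer to layer 0 is a genuine condition, namely
  \<open>wrap_cong\<close>.\<close>

lemma xmat_mult_ymat: "xmat * ymat = ymat * xmat ^\<^sub>m (1 + p)"
proof (rule eq_on_bvec)
  fix l e assume l: "l < p ^ d"
  have "(ymat * xmat ^\<^sub>m (1 + p)) *\<^sub>v bvec l e = ymat *\<^sub>v bvec l (e + c * (1 + p) ^ Suc l)"
  proof -
    have "(1 + p) * (c * (1 + p) ^ l) = c * (1 + p) ^ Suc l" by (simp only: power_Suc mult_ac)
    then show ?thesis
      using xmat_pow_bvec[OF l, of "1 + p" e]
      by (subst assoc_mult_mat_vec[of _ rsize rsize _ rsize]) (auto simp del: pow_mat.simps)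
  qed
  moreover have "xmat *\<^sub>v (ymat *\<^sub>v bvec l e) = ymat *\<^sub>v bvec l (e + c * (1 + p) ^ Suc l)"
  proof (cases "l + 1 < p ^ d")
    case True
    then show ?thesis by (simp only: ymat_bvec_Suc[OF True] xmat_bvec) (simp only: Suc_eq_plus1)
  next
    case False
    then have l1: "l + 1 = p ^ d" using l by simp
    have "bvec 0 (u * e + t + c) = bvec 0 (u * (e + c * (1 + p) ^ Suc l) + t)"
    proof (rule bvec_cong)
      have "[u * e + t + u * (c * (1 + p) ^ p ^ d) = u * e + t + c] (mod p ^ (a + M))"
        by (intro cong_add wrap_cong) auto
      then show "[u * e + t + c = u * (e + c * (1 + p) ^ Suc l) + t] (mod p ^ (a + M))"
        using l1 by (simp add: cong_sym algebra_simps)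
    qed
    then show ?thesis using p_pos by (simp add: ymat_bvec_wrap[OF l1] xmat_bvec)
  qed
  ultimately show "(xmat * ymat) *\<^sub>v bvec l e = (ymat * xmat ^\<^sub>m (1 + p)) *\<^sub>v bvec l e"
    by (simp add: assoc_mult_mat_vec[of _ rsize rsize _ rsize])
qed (auto intro!: mult_carrier_mat[of _ rsize rsize])

text \<open>On layer \<open>l\<close> the scalar has exponent
  \<open>p ^ d * c * (1 + p) ^ l\<close>. By \<open>c_cong\<close> the first part is a multiple of
  \<open>p ^ (M - 1)\<close> modulo \<open>p ^ M\<close>, and the power of \<open>1 + p\<close> is 1
  modulo \<open>p\<close>, so all layers agree.\<close>

lemma xmat_pow_dim: "xmat ^\<^sub>m rsize = z ^ (s * p ^ (M - 1)) \<cdot>\<^sub>m 1\<^sub>m rsize"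
proof (rule eq_on_bvec)
  fix l e assume l: "l < p ^ d"
  have "[(p ^ d * c) * (1 + p) ^ l = s * p ^ (M - 1)] (mod p ^ M)"
  proof (cases M)
    case (Suc k)
    have "[1 + p = 1] (mod p)" using cong_add[OF cong_refl[of 1] cong_mult_self_left[of p 1]] by simp
    then have "[(1 + p) ^ l = 1] (mod p)" using cong_pow[of "1 + p" 1 p l] by simp
    then have "[s * (p ^ k * (1 + p) ^ l) = s * (p ^ k * 1)] (mod p ^ k * p)"
      by (rule cong_mult[OF cong_refl cong_cmult_leftI])
    moreover have "[(p ^ d * c) * (1 + p) ^ l = (s * p ^ k) * (1 + p) ^ l] (mod p ^ M)"
      by (rule cong_mult[OF _ cong_refl]) (use c_cong in \<open>simp add: Suc\<close>)
    ultimately show ?thesis by (simp add: Suc mult.assoc mult.commute[of p] cong_trans)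
  qed simp
  moreover have "xmat ^\<^sub>m rsize *\<^sub>v bvec l e = z ^ ((p ^ d * c) * (1 + p) ^ l) \<cdot>\<^sub>v bvec l e"
    unfolding xmat_pow_bvec[OF l] bvec_shift[symmetric] by (simp add: power_add mult_ac)
  ultimately show "xmat ^\<^sub>m rsize *\<^sub>v bvec l e = (z ^ (s * p ^ (M - 1)) \<cdot>\<^sub>m 1\<^sub>m rsize) *\<^sub>v bvec l e"
    by (simp add: z_power_cong smult_one_mat_mult_vec)
qed auto

text \<open>This is \<open>p ^ a\<close> iterations of the affine map. The geometric sum congruences
  for odd \<open>p\<close> reduce the result to \<open>e + p ^ a * t\<close>, a multiplication by
  \<open>z ^ t\<close>.\<close>

lemma ymat_pow_dim:
  assumes "M \<ge> 1 \<or> a = 0"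
  shows "ymat ^\<^sub>m rsize = z ^ t \<cdot>\<^sub>m 1\<^sub>m rsize"
proof (rule eq_on_bvec)
  fix l e assume l: "l < p ^ d"
  have "[u ^ p ^ a = 1] (mod p ^ (a + M))" "[(\<Sum>i<p ^ a. u ^ i) = p ^ a] (mod p ^ (a + M))"
  proof -
    have "[int u ^ p ^ a = 1] (mod int p ^ (a + M)) \<and> [(\<Sum>i<p ^ a. int u ^ i) = int p ^ a] (mod int p ^ (a + M))"
    proof (cases "M = 0")
      case False
      have "[int u = 1] (mod int p ^ M)"
        using u_cong unfolding cong_int_iff[symmetric] by simp
      with False show ?thesis
        using odd_p power_prime_power_cong_1[of p M] geometric_sum_prime_power_cong[of p M] by simp
    qed (use assms in auto)
    then show "[u ^ p ^ a = 1] (mod p ^ (a + M))" "[(\<Sum>i<p ^ a. u ^ i) = p ^ a] (mod p ^ (a + M))"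
      unfolding cong_int_iff[symmetric] by simp_all
  qed
  then have "[u ^ p ^ a * e + t * (\<Sum>i<p ^ a. u ^ i) = 1 * e + t * p ^ a] (mod p ^ (a + M))"
    by (intro cong_add cong_mult cong_refl)
  then have "bvec l (u ^ p ^ a * e + t * (\<Sum>i<p ^ a. u ^ i)) = bvec l (e + p ^ a * t)"
    by (intro bvec_cong) (simp add: mult.commute)
  moreover have "rsize = p ^ d * p ^ a" by (simp add: power_add)
  ultimately have "ymat ^\<^sub>m rsize *\<^sub>v bvec l e = z ^ t \<cdot>\<^sub>v bvec l e"
    using ymat_pow_bvec_multiple[OF l, of "p ^ a" e] by (simp only: bvec_shift)
  then show "ymat ^\<^sub>m rsize *\<^sub>v bvec l e = (z ^ t \<cdot>\<^sub>m 1\<^sub>m rsize) *\<^sub>v bvec l e"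
    by (simp add: smult_one_mat_mult_vec)
qed auto

lemma bvec_cyclotomic: "i < rsize \<Longrightarrow> bvec l e $ i \<in> cyclotomic_field (p ^ M)"
  using subfield_cyclotomic_field[of "p ^ M"] zeta_in_cyclotomic_field
  by (auto simp: bvec_def unit_vec_def is_subfield_of_complex_def intro: subfield_power[OF subfield_cyclotomic_field])

lemma elements_xmat_ymat:
  "elements_mat xmat \<subseteq> cyclotomic_field (p ^ M)" "elements_mat ymat \<subseteq> cyclotomic_field (p ^ M)"
  by (auto simp: elements_mat_def xmat_def ymat_def of_cols_def bvec_cyclotomic)

end

text \<open>Stated for monoids so that it serves both the group and the matrices under
  multiplication.\<close>

lemma (in monoid) twisted_pow_commute:
  fixes i j q :: nat
  assumes "x \<in> carrier G" "y \<in> carrier G" "x \<otimes> y = y \<otimes> x [^] q"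
  shows "x [^] i \<otimes> y [^] j = y [^] j \<otimes> x [^] (i * q ^ j)"
proof -
  have pow: "x [^] k \<otimes> y = y \<otimes> x [^] (k * q)" for k :: nat
  proof (induction k)
    case (Suc k)
    have "x [^] Suc k \<otimes> y = x [^] k \<otimes> (y \<otimes> x [^] q)"
      using assms by (simp add: m_assoc)
    also have "\<dots> = y \<otimes> x [^] (k * q) \<otimes> x [^] q"
      using assms Suc by (simp add: m_assoc[symmetric])
    also have "\<dots> = y \<otimes> x [^] (Suc k * q)"
      using assms by (simp add: m_assoc nat_pow_mult add.commute)
    finally show ?case .
  qed (use assms in simp)
  show ?thesis
  proof (induction j)
    case (Suc j)
    have "x [^] i \<otimes> y [^] Suc j = y [^] j \<otimes> (x [^] (i * q ^ j) \<otimes> y)"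
      using assms Suc by (simp add: m_assoc[symmetric])
    also have "\<dots> = y [^] Suc j \<otimes> x [^] (i * q ^ j * q)"
      using assms by (simp add: pow m_assoc)
    finally show ?case by (simp add: mult_ac)
  qed (use assms in simp)
qed

lemma (in monoid) twisted_normal_mult:
  fixes i j i' j' q :: nat
  assumes "x \<in> carrier G" "y \<in> carrier G" "x \<otimes> y = y \<otimes> x [^] q"
  shows "(y [^] j \<otimes> x [^] i) \<otimes> (y [^] j' \<otimes> x [^] i') = y [^] (j + j') \<otimes> x [^] (i * q ^ j' + i')"
proof -
  have "(y [^] j \<otimes> x [^] i) \<otimes> (y [^] j' \<otimes> x [^] i') = y [^] j \<otimes> (x [^] i \<otimes> y [^] j') \<otimes> x [^] i'"
    using assms by (simp add: m_assoc)
  also have "\<dots> = (y [^] j \<otimes> y [^] j') \<otimes> (x [^] (i * q ^ j') \<otimes> x [^] i')"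
    unfolding twisted_pow_commute[OF assms] using assms by (simp add: m_assoc)
  finally show ?thesis using assms by (simp add: nat_pow_mult)
qed

definition mat_trace :: "'a :: comm_monoid_add mat \<Rightarrow> 'a" where
  "mat_trace A = (\<Sum>i<dim_row A. A $$ (i, i))"

lemma mat_trace_mult_commute:
  fixes A B :: "'a :: comm_semiring_1 mat"
  assumes "A \<in> carrier_mat n m" "B \<in> carrier_mat m n"
  shows "mat_trace (A * B) = mat_trace (B * A)"
proof -
  have "mat_trace (A * B) = (\<Sum>i<n. \<Sum>j<m. A $$ (i, j) * B $$ (j, i))"
    using assms by (auto simp: mat_trace_def scalar_prod_def atLeast0LessThan intro!: sum.cong)
  also have "\<dots> = (\<Sum>j<m. \<Sum>i<n. B $$ (j, i) * A $$ (i, j))"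
    by (subst sum.swap) (simp add: mult.commute)
  also have "\<dots> = mat_trace (B * A)"
    using assms by (auto simp: mat_trace_def scalar_prod_def atLeast0LessThan intro!: sum.cong)
  finally show ?thesis .
qed

lemma mat_trace_smult:
  fixes A :: "'a :: semiring_0 mat"
  assumes "A \<in> carrier_mat n n"
  shows "mat_trace (k \<cdot>\<^sub>m A) = k * mat_trace A"
  using assms by (auto simp: mat_trace_def sum_distrib_left)

lemma mat_trace_one: "mat_trace (1\<^sub>m n :: 'a :: semiring_1 mat) = of_nat n"
  by (simp add: mat_trace_def)

text \<open>If \<open>M \<ge> r + 1\<close>, the field contains the eigenvalues of \<open>A\<close>,
  and \<open>A\<close> is taken diagonal (a = 0, d = r). For 1 <= M <= r only M - 1 of the r levels
  fit into layers; on each layer \<open>A\<close> becomes a monomial block of size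
  \<open>p ^ a\<close> whose \<open>p ^ a\<close>-th power is a scalar in the field. If
  \<open>M = 0\<close>, everything is 1 by 1.\<close>

lemma exists_rep_matrices:
  assumes p: "Factorial_Ring.prime p" "odd p" and M: "M = 0 \<Longrightarrow> r = 0"
  obtains A B where "A \<in> carrier_mat (p ^ r) (p ^ r)" "B \<in> carrier_mat (p ^ r) (p ^ r)"
    "elements_mat A \<subseteq> cyclotomic_field (p ^ M)" "elements_mat B \<subseteq> cyclotomic_field (p ^ M)"
    "A * B = B * A ^\<^sub>m (1 + p)"
    "A ^\<^sub>m (p ^ r) = zeta (p ^ M) ^ (s * p ^ (M - 1)) \<cdot>\<^sub>m 1\<^sub>m (p ^ r)"
    "B ^\<^sub>m (p ^ r) = zeta (p ^ M) ^ t \<cdot>\<^sub>m 1\<^sub>m (p ^ r)"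
proof -
  have one_p: "[(1 + p) ^ p ^ k = 1] (mod p ^ Suc k)" for k
    using power_prime_power_cong_1[OF p(2), of 1 "1 + int p" k]
    unfolding cong_int_iff[symmetric] by (simp add: cong_iff_dvd_diff)
  have "\<exists>a d c u. a + d = r \<and> monomial_rep p a d M c u s \<and> (M \<ge> 1 \<or> a = 0)"
  proof (cases "M = 0 \<or> M \<ge> r + 1")
    case True
    \<comment> \<open>Forced by \<open>p ^ r * c = s * p ^ (M - 1)\<close>; the subtraction is exact
      when \<open>M \<ge> r + 1\<close>.\<close>
    define c where "c = (if M = 0 then 0 else s * p ^ (M - 1 - r))"
    have "[1 * (c * (1 + p) ^ p ^ r) = c] (mod p ^ (0 + M))"
    proof (cases "M = 0")
      case False
      with True have "M = (M - 1 - r) + Suc r" by simp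
      then have pM: "p ^ M = p ^ (M - 1 - r) * p ^ Suc r" by (metis power_add)
      have "[s * (p ^ (M - 1 - r) * (1 + p) ^ p ^ r) = s * (p ^ (M - 1 - r) * 1)] (mod p ^ M)"
        unfolding pM by (intro cong_mult[OF cong_refl cong_cmult_leftI] one_p)
      then show ?thesis using False by (simp add: c_def mult.assoc)
    qed simp
    moreover have "[p ^ r * c = s * p ^ (M - 1)] (mod p ^ M)"
    proof (cases "M = 0")
      case False
      with True have "M - 1 = r + (M - 1 - r)" by simp
      then have "p ^ (M - 1) = p ^ r * p ^ (M - 1 - r)" by (metis power_add)
      then show ?thesis using False by (simp add: c_def mult_ac)
    qed simp
    ultimately have "monomial_rep p 0 r M c 1 s" using p by unfold_locales auto
    then show ?thesis by (metis add_0)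
  next
    case False
    \<comment> \<open>With this \<open>d\<close> the choice \<open>c = s\<close> satisfies
      \<open>c_cong\<close>, and \<open>(1 + p) ^ p ^ d\<close> is 1 modulo exactly the required
      \<open>p ^ M\<close>.\<close>
    define d where "d = M - 1"
    define a where "a = r - d"
    have M: "M = Suc d" and r: "a + d = r" using False by (auto simp: a_def d_def)
    have "Rings.coprime (1 + p) p" using coprime_Suc_left_nat[of p] by simp
    then have "Rings.coprime ((1 + p) ^ p ^ d) (p ^ (a + M))" by simp
    \<comment> \<open>\<open>u\<close> undoes the twist accumulated over all \<open>p ^ d\<close>
      layers, as the wrap demands.\<close>
    then obtain u where u: "[(1 + p) ^ p ^ d * u = 1] (mod p ^ (a + M))"
      using cong_solve_coprime_nat by (metis One_nat_def)
    have "[u * (s * (1 + p) ^ p ^ d) = s] (mod p ^ (a + M))"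
      using cong_mult[OF cong_refl[of s] u] by (simp add: mult_ac)
    moreover have "[u = 1] (mod p ^ M)"
    proof -
      have "[(1 + p) ^ p ^ d * u = 1] (mod p ^ M)"
        using u unfolding add.commute[of a] power_add by (rule cong_modulus_mult_nat)
      moreover have "[(1 + p) ^ p ^ d * u = 1 * u] (mod p ^ M)"
        unfolding M by (rule cong_mult[OF one_p cong_refl])
      ultimately show ?thesis by (metis cong_sym cong_trans mult_1)
    qed
    ultimately have "monomial_rep p a d M s u s"
      using p by unfold_locales (auto simp: M mult.commute)
    then show ?thesis using r M by auto
  qed
  then obtain a d c u where r: "a + d = r" and rep: "monomial_rep p a d M c u s" and Ma: "M \<ge> 1 \<or> a = 0" by blast
  interpret monomial_rep p a d M c u t s by (rule rep)
  show thesis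
    by (rule that[of xmat ymat, folded r, OF xmat_carrier ymat_carrier elements_xmat_ymat
          xmat_mult_ymat xmat_pow_dim ymat_pow_dim[OF Ma]])
qed

section \<open>Character values from the twisted relation\<close>

lemma pow_mat_add:
  fixes C :: "'a :: semiring_1 mat"
  assumes C: "C \<in> carrier_mat n n"
  shows "C ^\<^sub>m (k + l) = C ^\<^sub>m k * C ^\<^sub>m l"
proof -
  interpret R: semiring "ring_mat TYPE('a) n ()" by (rule semiring_mat)
  show ?thesis
    using C R.nat_pow_mult[of C k l]
    by (simp add: pow_mat_ring_pow[OF C, where b = "()"] ring_mat_simps)
qed

lemma pow_mat_mult_scalar:
  fixes C :: "'a :: comm_ring_1 mat"
  assumes C: "C \<in> carrier_mat n n" and Cm: "C ^\<^sub>m m = c \<cdot>\<^sub>m 1\<^sub>m n"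
  shows "C ^\<^sub>m (m * k) = c ^ k \<cdot>\<^sub>m 1\<^sub>m n"
proof (induction k)
  case 0
  then show ?case using C by auto
next
  case (Suc k)
  have "C ^\<^sub>m (m * Suc k) = (c ^ k \<cdot>\<^sub>m 1\<^sub>m n) * (c \<cdot>\<^sub>m 1\<^sub>m n)"
    using pow_mat_add[OF C, of "m * k" m] Suc Cm by (simp add: add.commute)
  also have "\<dots> = c ^ Suc k \<cdot>\<^sub>m 1\<^sub>m n"
    by (subst mult_smult_distrib[of _ n n _ n]) auto
  finally show ?case .
qed

text \<open>The character values follow from these relations alone. Primitivity of
  \<open>\<alpha>\<close> is asked only for \<open>r > 0\<close>; one-dimensional representations
  may be trivial on x.\<close>

locale twisted_pair =
  fixes p r :: nat and A B :: "complex mat" and \<alpha> \<beta> :: complex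
  assumes prime_p: "Factorial_Ring.prime p" and odd_p: "odd p"
    and A: "A \<in> carrier_mat (p ^ r) (p ^ r)" and B: "B \<in> carrier_mat (p ^ r) (p ^ r)"
    and twist: "A * B = B * A ^\<^sub>m (1 + p)"
    and A_pow: "A ^\<^sub>m (p ^ r) = \<alpha> \<cdot>\<^sub>m 1\<^sub>m (p ^ r)"
    and B_pow: "B ^\<^sub>m (p ^ r) = \<beta> \<cdot>\<^sub>m 1\<^sub>m (p ^ r)"
    and \<alpha>_pow: "\<alpha> ^ p = 1" and \<beta>_nz: "\<beta> \<noteq> 0"
    and \<alpha>_primitive: "\<And>w. r > 0 \<Longrightarrow> \<not> p dvd w \<Longrightarrow> \<alpha> ^ w \<noteq> 1"
begin

abbreviation "R \<equiv> ring_mat TYPE(complex) (p ^ r) ()"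

definition rep :: "nat \<Rightarrow> nat \<Rightarrow> complex mat" where
  "rep j i = B ^\<^sub>m j * A ^\<^sub>m i"

lemma pow_carrier [simp]: "A ^\<^sub>m i \<in> carrier_mat (p ^ r) (p ^ r)" "B ^\<^sub>m i \<in> carrier_mat (p ^ r) (p ^ r)"
  using pow_carrier_mat[OF A] pow_carrier_mat[OF B] by simp_all

lemma rep_carrier [simp]: "rep j i \<in> carrier_mat (p ^ r) (p ^ r)"
  unfolding rep_def by (rule mult_carrier_mat[OF pow_carrier(2) pow_carrier(1)])

lemma rep_mult: "rep j i * rep j' i' = rep (j + j') (i * (1 + p) ^ j' + i')"
proof -
  interpret R: semiring R by (rule semiring_mat)
  have "A \<otimes>\<^bsub>R\<^esub> B = B \<otimes>\<^bsub>R\<^esub> A [^]\<^bsub>R\<^esub> (1 + p)"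
    using twist by (simp add: pow_mat_ring_pow[OF A, where b = "()"] ring_mat_simps)
  from R.twisted_normal_mult[OF _ _ this, of j i j' i']
  show ?thesis using A B
    by (simp add: rep_def pow_mat_ring_pow[OF A, where b = "()"] pow_mat_ring_pow[OF B, where b = "()"] ring_mat_simps)
qed

lemma rep_00: "rep 0 0 = 1\<^sub>m (p ^ r)"
  using A B by (simp add: rep_def)

lemma rep_add_multiple:
  "rep (j + p ^ r * l) (i + p ^ r * k) = (\<alpha> ^ k * \<beta> ^ l) \<cdot>\<^sub>m rep j i"
proof -
  let ?one = "1\<^sub>m (p ^ r) :: complex mat"
  have one: "C * (c \<cdot>\<^sub>m ?one) = c \<cdot>\<^sub>m C" if "C \<in> carrier_mat (p ^ r) (p ^ r)" for C c
    using that by (simp add: mult_smult_distrib[of _ "p ^ r" "p ^ r" _ "p ^ r"])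
  have "rep (j + p ^ r * l) (i + p ^ r * k) = (\<beta> ^ l \<cdot>\<^sub>m B ^\<^sub>m j) * (\<alpha> ^ k \<cdot>\<^sub>m A ^\<^sub>m i)"
    unfolding rep_def pow_mat_add[OF A] pow_mat_add[OF B]
      pow_mat_mult_scalar[OF A A_pow] pow_mat_mult_scalar[OF B B_pow] one[OF pow_carrier(1)] one[OF pow_carrier(2)] ..
  also have "\<dots> = \<beta> ^ l \<cdot>\<^sub>m (\<alpha> ^ k \<cdot>\<^sub>m rep j i)"
    unfolding rep_def
    by (subst mult_smult_assoc_mat[of _ "p ^ r" "p ^ r" _ "p ^ r"])
      (auto simp: mult_smult_distrib[of _ "p ^ r" "p ^ r" _ "p ^ r"])
  also have "\<dots> = (\<alpha> ^ k * \<beta> ^ l) \<cdot>\<^sub>m rep j i"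
    by (intro eq_matI) auto
  finally show ?thesis .
qed

lemma mat_trace_rep_commute: "mat_trace (rep j i * rep j' i') = mat_trace (rep j' i' * rep j i)"
  by (rule mat_trace_mult_commute[OF rep_carrier rep_carrier])

lemma not_prime_power_dvdE:
  assumes "\<not> p ^ r dvd k"
  obtains v k' where "k = p ^ v * k'" "\<not> p dvd k'" "v < r"
proof -
  have "k \<noteq> 0" using assms by (metis dvd_0_right)
  moreover have "\<not> is_unit p" using prime_p by auto
  ultimately obtain k' where k: "k = p ^ multiplicity p k * k'" "\<not> p dvd k'"
    using multiplicity_decompose' by blast
  moreover have "multiplicity p k < r"
    using assms k by (metis dvd_mult2 le_imp_power_dvd not_le)
  ultimately show ?thesis using that by blast
qed

text \<open>Conjugating by a suitable power of one generator multiplies the matrix by a nontrivial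
  power of \<open>\<alpha>\<close> unless both exponents are divisible by \<open>p ^ r\<close>.\<close>
lemma mat_trace_rep:
  "mat_trace (rep j i) =
    (if p ^ r dvd i \<and> p ^ r dvd j then of_nat (p ^ r) * (\<alpha> ^ (i div p ^ r) * \<beta> ^ (j div p ^ r)) else 0)"
proof -
  have p0: "p > 0" using prime_p prime_gt_0_nat by blast
  show ?thesis
  proof (cases "p ^ r dvd j")
    case False
    then obtain v j' where j: "j = p ^ v * j'" "\<not> p dvd j'" "v < r" by (rule not_prime_power_dvdE)
    obtain w where w: "(1 + p) ^ j = 1 + p ^ (v + 1) * w" "\<not> p dvd w"
      unfolding j(1) using one_plus_prime_power_valuation[OF prime_p odd_p j(2)] by blast
    \<comment> \<open>Moving \<open>A ^ l\<close> past \<open>B ^ j\<close> changes the exponent by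
      l((1+p)^j - 1), which for this \<open>l\<close> is \<open>p ^ r * w\<close> with
      \<open>w\<close> prime to \<open>p\<close>; the scalar that appears is \<alpha>^w, different
      from 1.\<close>
    define l where "l = p ^ (r - 1 - v)"
    have "r = (r - 1 - v) + (v + 1)" using j(3) by simp
    then have "p ^ r = l * p ^ (v + 1)" unfolding l_def by (metis power_add)
    then have lw: "l * (1 + p) ^ j = l + p ^ r * w" unfolding w(1) by (simp add: algebra_simps)
    \<comment> \<open>Exponents are natural numbers, so conjugation is replaced by comparing two
      products. Raising \<open>i\<close> by \<open>p ^ r * p\<close> makes room to subtract
      \<open>l\<close> and is harmless because \<alpha>^p = 1.\<close>
    have "l \<le> p ^ r" unfolding l_def using p0 by (intro power_increasing) auto
    also have "\<dots> \<le> p ^ r * p" using p0 by simp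
    finally obtain i' where i': "i + p ^ r * p = i' + l" by (metis add.commute le_add_diff_inverse trans_le_add2)
    have "rep 0 l * rep j i' = \<alpha> ^ w \<cdot>\<^sub>m rep j (i' + l)"
      using rep_add_multiple[of j 0 "i' + l" w] unfolding rep_mult lw by (simp add: add_ac)
    moreover have "rep j i' * rep 0 l = rep j (i' + l)" by (simp add: rep_mult)
    ultimately have "\<alpha> ^ w * mat_trace (rep j (i' + l)) = mat_trace (rep j (i' + l))"
      using mat_trace_rep_commute[of 0 l j i'] by (simp add: mat_trace_smult[OF rep_carrier])
    then have "mat_trace (rep j (i' + l)) = 0"
      using \<alpha>_primitive[OF _ w(2)] j(3) by auto
    moreover have "rep j (i' + l) = rep j i"
      using rep_add_multiple[of j 0 i p] by (auto simp: \<alpha>_pow i'[symmetric] intro!: eq_matI)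
    ultimately show ?thesis using False by simp
  next
    case j: True
    show ?thesis
    proof (cases "p ^ r dvd i")
      case False
      then obtain v i' where i: "i = p ^ v * i'" "\<not> p dvd i'" "v < r" by (rule not_prime_power_dvdE)
      \<comment> \<open>Now \<open>B ^ l\<close> is moved: i((1+p)^l - 1) equals
        \<open>p ^ r * (i' * w)\<close>, since \<open>i\<close> supplies p^v and the power of
        \<open>1 + p\<close> the remaining p^(r-v).\<close>
      define l where "l = p ^ (r - 1 - v)"
      have "\<not> p dvd 1" using prime_p by auto
      then obtain w where w: "(1 + p) ^ l = 1 + p ^ (r - 1 - v + 1) * w" "\<not> p dvd w"
        unfolding l_def using one_plus_prime_power_valuation[OF prime_p odd_p, of 1] by (metis mult_1_right)
      have "r = v + (r - 1 - v + 1)" using i(3) by simp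
      then have "p ^ r = p ^ v * p ^ (r - 1 - v + 1)" by (metis power_add)
      then have lw: "i * (1 + p) ^ l = i + p ^ r * (i' * w)" unfolding w(1) i(1) by (simp add: algebra_simps)
      have iw: "\<not> p dvd i' * w" using i(2) w(2) prime_p by (simp add: prime_dvd_mult_iff)
      \<comment> \<open>Raising \<open>j\<close> by \<open>p ^ r\<close> costs the factor \<beta>,
        which is cancelled at the end because it is nonzero.\<close>
      have "l \<le> p ^ r" unfolding l_def using p0 by (intro power_increasing) auto
      then obtain j' where j': "j + p ^ r = j' + l" by (metis add.commute le_add_diff_inverse trans_le_add2)
      have "rep j' i * rep l 0 = \<alpha> ^ (i' * w) \<cdot>\<^sub>m rep (j' + l) i"
        using rep_add_multiple[of "j' + l" 0 i "i' * w"] unfolding rep_mult lw by simp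
      moreover have "rep l 0 * rep j' i = rep (j' + l) i" by (simp add: rep_mult add.commute)
      ultimately have "\<alpha> ^ (i' * w) * mat_trace (rep (j' + l) i) = mat_trace (rep (j' + l) i)"
        using mat_trace_rep_commute[of l 0 j' i] by (simp add: mat_trace_smult[OF rep_carrier])
      then have "mat_trace (rep (j' + l) i) = 0"
        using \<alpha>_primitive[OF _ iw] i(3) by auto
      moreover have "rep (j' + l) i = \<beta> \<cdot>\<^sub>m rep j i"
        using rep_add_multiple[of j 1 i 0] by (simp add: j'[symmetric])
      ultimately have "mat_trace (rep j i) = 0"
        using \<beta>_nz by (simp add: mat_trace_smult[OF rep_carrier])
      then show ?thesis using False by simp
    next
      case True
      with j obtain k l where "i = p ^ r * k" "j = p ^ r * l" by (auto elim!: dvdE)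
      then show ?thesis
        using rep_add_multiple[of 0 l 0 k] p0
        by (simp add: rep_00 mat_trace_smult[of _ "p ^ r"] mat_trace_one)
    qed
  qed
qed

end

section \<open>An isomorphism criterion for rational group algebras\<close>

lemma sum_fun_apply: "(\<Sum>i\<in>A. f i) x = (\<Sum>i\<in>A. f i x)"
  by (induction A rule: infinite_finite_induct) simp_all

lemma vector_space_dsum_smult: "vector_space (dsum_smult :: rat \<Rightarrow> dsum_elem \<Rightarrow> dsum_elem)"
  by unfold_locales (auto simp: dsum_smult_def fun_eq_iff algebra_simps of_rat_add of_rat_mult)

definition dsum_unit :: "nat \<Rightarrow> nat \<Rightarrow> nat \<Rightarrow> complex \<Rightarrow> dsum_elem" where
  "dsum_unit b i j z = (\<lambda>b' i' j'. if b' = b \<and> i' = i \<and> j' = j then z else 0)"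

lemma dsum_carrier_subset_span:
  fixes L :: blocks and d :: "nat \<Rightarrow> nat" and w :: "nat \<Rightarrow> nat \<Rightarrow> complex"
  assumes span: "\<And>b z. b < length L \<Longrightarrow> z \<in> cyclotomic_field (snd (L ! b)) \<Longrightarrow>
      \<exists>a :: nat \<Rightarrow> rat. z = (\<Sum>k<d b. of_rat (a k) * w b k)"
  obtains T where "finite T" "card T \<le> (\<Sum>b<length L. fst (L ! b) ^ 2 * d b)"
    "dsum_carrier L \<subseteq> module.span dsum_smult T"
proof -
  interpret V: vector_space "dsum_smult :: rat \<Rightarrow> dsum_elem \<Rightarrow> dsum_elem"
    by (rule vector_space_dsum_smult)
  define S where "S = (SIGMA b : {..<length L}. {..<fst (L ! b)} \<times> {..<fst (L ! b)} \<times> {..<d b})"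
  define T where "T = (\<lambda>(b, i, j, k). dsum_unit b i j (w b k)) ` S"
  have fin: "finite S" by (auto simp: S_def)
  have "card T \<le> card S" unfolding T_def by (rule card_image_le[OF fin])
  also have "card S = (\<Sum>b<length L. fst (L ! b) ^ 2 * d b)"
    by (simp add: S_def power2_eq_square mult.assoc)
  finally have "card T \<le> \<dots>" .
  moreover have "finite T" using fin by (simp add: T_def)
  moreover have "dsum_carrier L \<subseteq> V.span T"
  proof
    fix D assume D: "D \<in> dsum_carrier L"
    define Idx where "Idx = (SIGMA b : {..<length L}. {..<fst (L ! b)} \<times> {..<fst (L ! b)})"
    have fin: "finite Idx" by (auto simp: Idx_def)
    have "D = (\<Sum>(b, i, j)\<in>Idx. dsum_unit b i j (D b i j))"
    proof (intro ext)
      fix b i j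
      have "(\<Sum>(b', i', j')\<in>Idx. dsum_unit b' i' j' (D b' i' j')) b i j =
          (\<Sum>q\<in>Idx. if q = (b, i, j) then D b i j else 0)"
        unfolding sum_fun_apply by (intro sum.cong) (auto simp: dsum_unit_def split: if_splits)
      also have "\<dots> = (if in_block L b i j then D b i j else 0)"
        using fin by (auto simp: Idx_def in_block_def)
      also have "\<dots> = D b i j" using D by (auto simp: dsum_carrier_def)
      finally show "D b i j = (\<Sum>(b, i, j)\<in>Idx. dsum_unit b i j (D b i j)) b i j" by simp
    qed
    moreover have "dsum_unit b i j (D b i j) \<in> V.span T" if q: "(b, i, j) \<in> Idx" for b i j
    proof -
      have "b < length L" "D b i j \<in> cyclotomic_field (snd (L ! b))"
        using q D by (auto simp: Idx_def dsum_carrier_def in_block_def split: if_splits)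
      then obtain a :: "nat \<Rightarrow> rat" where a: "D b i j = (\<Sum>k<d b. of_rat (a k) * w b k)"
        using span by blast
      have "dsum_unit b i j (D b i j) = (\<Sum>k<d b. dsum_smult (a k) (dsum_unit b i j (w b k)))"
        by (auto simp: fun_eq_iff sum_fun_apply dsum_unit_def dsum_smult_def a)
      also have "\<dots> \<in> V.span T"
      proof (intro V.span_sum V.span_scale V.span_base)
        fix k assume "k \<in> {..<d b}"
        then show "dsum_unit b i j (w b k) \<in> T"
          unfolding T_def using q by (intro image_eqI[of _ _ "(b, i, j, k)"]) (auto simp: S_def Idx_def)
      qed
      finally show ?thesis .
    qed
    then have "(\<Sum>(b, i, j)\<in>Idx. dsum_unit b i j (D b i j)) \<in> V.span T"
      by (intro V.span_sum) auto
    ultimately show "D \<in> V.span T" by simp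
  qed
  ultimately show thesis using that by blast
qed

text \<open>The representations extend linearly to an algebra homomorphism; \<open>inj\<close> makes
  it injective. Surjectivity is a count over Q: the images of the group elements are independent,
  and \<open>span\<close> with \<open>card\<close> bounds the dimension of the target by their
  number.\<close>

lemma (in group) QG_iso_dsum_criterion:
  fixes L :: blocks and \<rho> :: "nat \<Rightarrow> 'a \<Rightarrow> complex mat"
    and d :: "nat \<Rightarrow> nat" and w :: "nat \<Rightarrow> nat \<Rightarrow> complex"
  assumes fin: "finite (carrier G)"
    and dims: "\<And>b g. b < length L \<Longrightarrow> \<rho> b g \<in> carrier_mat (fst (L ! b)) (fst (L ! b))"
    and mult: "\<And>b g h. b < length L \<Longrightarrow> g \<in> carrier G \<Longrightarrow> h \<in> carrier G \<Longrightarrow> \<rho> b (g \<otimes> h) = \<rho> b g * \<rho> b h"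
    and one: "\<And>b. b < length L \<Longrightarrow> \<rho> b \<one> = 1\<^sub>m (fst (L ! b))"
    and field: "\<And>b f i j. b < length L \<Longrightarrow> i < fst (L ! b) \<Longrightarrow> j < fst (L ! b) \<Longrightarrow>
        (\<Sum>g\<in>carrier G. of_rat (f g) * \<rho> b g $$ (i, j)) \<in> cyclotomic_field (snd (L ! b))"
    and inj: "\<And>f g. (\<And>b i j. b < length L \<Longrightarrow> i < fst (L ! b) \<Longrightarrow> j < fst (L ! b) \<Longrightarrow>
        (\<Sum>g\<in>carrier G. of_rat (f g) * \<rho> b g $$ (i, j)) = 0) \<Longrightarrow> g \<in> carrier G \<Longrightarrow> f g = 0"
    and span: "\<And>b z. b < length L \<Longrightarrow> z \<in> cyclotomic_field (snd (L ! b)) \<Longrightarrow>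
        \<exists>a :: nat \<Rightarrow> rat. z = (\<Sum>k<d b. of_rat (a k) * w b k)"
    and card: "(\<Sum>b<length L. fst (L ! b) ^ 2 * d b) \<le> card (carrier G)"
  shows "QG_iso_dsum G L"
proof -
  interpret V: vector_space "dsum_smult :: rat \<Rightarrow> dsum_elem \<Rightarrow> dsum_elem"
    by (rule vector_space_dsum_smult)
  define \<phi> :: "('a \<Rightarrow> rat) \<Rightarrow> dsum_elem" where
    "\<phi> f = (\<lambda>b i j. if in_block L b i j then \<Sum>g\<in>carrier G. of_rat (f g) * \<rho> b g $$ (i, j) else 0)" for f
  have \<phi>_carrier: "\<phi> f \<in> dsum_carrier L" for f
    using field by (auto simp: dsum_carrier_def \<phi>_def in_block_def)
  have \<phi>_add: "\<phi> (QG_add f h) = dsum_add (\<phi> f) (\<phi> h)" for f h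
    by (auto simp: fun_eq_iff \<phi>_def QG_add_def dsum_add_def of_rat_add distrib_right sum.distrib)
  have \<phi>_smult: "\<phi> (QG_smult q f) = dsum_smult q (\<phi> f)" for q f
    by (auto simp: fun_eq_iff \<phi>_def QG_smult_def dsum_smult_def of_rat_mult sum_distrib_left mult.assoc)
  have \<phi>_one: "\<phi> (QG_one G) = dsum_one L"
  proof (intro ext)
    fix b i j
    have "(\<Sum>g\<in>carrier G. of_rat (QG_one G g) * \<rho> b g $$ (i, j)) =
        (\<Sum>g\<in>carrier G. if g = \<one> then \<rho> b g $$ (i, j) else 0)"
      by (intro sum.cong) (auto simp: QG_one_def)
    also have "\<dots> = \<rho> b \<one> $$ (i, j)" using fin by simp
    finally show "\<phi> (QG_one G) b i j = dsum_one L b i j"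
      using one by (auto simp: \<phi>_def dsum_one_def in_block_def)
  qed
  have \<phi>_mult: "\<phi> (QG_mult G f h) = dsum_mult L (\<phi> f) (\<phi> h)" for f h
  proof (intro ext)
    fix b i j
    show "\<phi> (QG_mult G f h) b i j = dsum_mult L (\<phi> f) (\<phi> h) b i j"
    proof (cases "in_block L b i j")
      case True
      then have b: "b < length L" and ij: "i < fst (L ! b)" "j < fst (L ! b)" by (auto simp: in_block_def)
      have "\<phi> (QG_mult G f h) b i j =
          (\<Sum>g\<in>carrier G. \<Sum>a\<in>carrier G. of_rat (f a) * of_rat (h (inv a \<otimes> g)) * \<rho> b g $$ (i, j))"
        using True by (simp add: \<phi>_def QG_mult_def of_rat_sum of_rat_mult sum_distrib_right)
      also have "\<dots> = (\<Sum>a\<in>carrier G. \<Sum>g\<in>carrier G. of_rat (f a) * of_rat (h (inv a \<otimes> g)) * \<rho> b g $$ (i, j))"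
        by (rule sum.swap)
      also have "\<dots> = (\<Sum>a\<in>carrier G. \<Sum>g\<in>carrier G. of_rat (f a) * of_rat (h g) * \<rho> b (a \<otimes> g) $$ (i, j))"
      proof (rule sum.cong[OF refl])
        fix a assume a: "a \<in> carrier G"
        show "(\<Sum>g\<in>carrier G. of_rat (f a) * of_rat (h (inv a \<otimes> g)) * \<rho> b g $$ (i, j)) =
            (\<Sum>g\<in>carrier G. of_rat (f a) * of_rat (h g) * \<rho> b (a \<otimes> g) $$ (i, j))"
          by (rule sum.reindex_bij_witness[of _ "\<lambda>g. a \<otimes> g" "\<lambda>g. inv a \<otimes> g"])
            (use a in \<open>auto simp: m_assoc[symmetric]\<close>)
      qed
      also have "\<dots> = (\<Sum>a\<in>carrier G. \<Sum>g\<in>carrier G. \<Sum>l<fst (L ! b).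
          (of_rat (f a) * \<rho> b a $$ (i, l)) * (of_rat (h g) * \<rho> b g $$ (l, j)))"
      proof (intro sum.cong refl)
        fix a g assume ag: "a \<in> carrier G" "g \<in> carrier G"
        have "\<rho> b (a \<otimes> g) $$ (i, j) = (\<Sum>l<fst (L ! b). \<rho> b a $$ (i, l) * \<rho> b g $$ (l, j))"
          using dims[OF b, of a] dims[OF b, of g] ij
          by (simp add: mult[OF b ag] scalar_prod_def atLeast0LessThan)
        then show "of_rat (f a) * of_rat (h g) * \<rho> b (a \<otimes> g) $$ (i, j) = (\<Sum>l<fst (L ! b).
          (of_rat (f a) * \<rho> b a $$ (i, l)) * (of_rat (h g) * \<rho> b g $$ (l, j)))"
          by (simp add: sum_distrib_left mult_ac)
      qed
      also have "\<dots> = (\<Sum>l<fst (L ! b). (\<Sum>a\<in>carrier G. of_rat (f a) * \<rho> b a $$ (i, l)) *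
          (\<Sum>g\<in>carrier G. of_rat (h g) * \<rho> b g $$ (l, j)))"
        unfolding sum_product by (simp only: sum.swap[of _ "{..<fst (L ! b)}"])
      also have "\<dots> = dsum_mult L (\<phi> f) (\<phi> h) b i j"
        using True ij by (simp add: dsum_mult_def \<phi>_def in_block_def)
      finally show ?thesis .
    qed (simp add: \<phi>_def dsum_mult_def)
  qed
  have \<phi>_eq_0: "f g = 0" if "\<phi> f = 0" "g \<in> carrier G" for f g
  proof (rule inj[OF _ that(2)])
    fix b i j assume "b < length L" "i < fst (L ! b)" "j < fst (L ! b)"
    then have "in_block L b i j" by (simp add: in_block_def)
    then show "(\<Sum>g\<in>carrier G. of_rat (f g) * \<rho> b g $$ (i, j)) = 0"
      using fun_cong[OF fun_cong[OF fun_cong[OF that(1), of b], of i], of j] by (simp add: \<phi>_def)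
  qed
  have "inj_on \<phi> (QG_carrier G)"
  proof (rule inj_onI)
    fix f h assume fh: "f \<in> QG_carrier G" "h \<in> QG_carrier G" "\<phi> f = \<phi> h"
    have "\<phi> (QG_add f (QG_smult (-1) h)) = 0"
      unfolding \<phi>_add \<phi>_smult fh(3) by (simp add: fun_eq_iff dsum_add_def dsum_smult_def)
    from \<phi>_eq_0[OF this] have "f g = h g" if "g \<in> carrier G" for g
      using that by (simp add: QG_add_def QG_smult_def)
    moreover have "f g = h g" if "g \<notin> carrier G" for g
      using that fh(1,2) by (simp add: QG_carrier_def)
    ultimately show "f = h" by blast
  qed
  moreover have "\<phi> ` QG_carrier G = dsum_carrier L"
  proof (intro equalityI subsetI)
    fix D assume D: "D \<in> dsum_carrier L"
    define \<delta> where "\<delta> g = (\<lambda>h. if h = g then 1 else 0 :: rat)" for g :: 'a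
    have \<phi>_sum: "\<phi> f = (\<Sum>g\<in>carrier G. dsum_smult (f g) (\<phi> (\<delta> g)))" for f
    proof (intro ext)
      fix b i j
      have "(\<Sum>h\<in>carrier G. of_rat (\<delta> g h) * \<rho> b h $$ (i, j)) = \<rho> b g $$ (i, j)" if "g \<in> carrier G" for g
      proof -
        have "(\<Sum>h\<in>carrier G. of_rat (\<delta> g h) * \<rho> b h $$ (i, j)) =
            (\<Sum>h\<in>carrier G. if h = g then \<rho> b h $$ (i, j) else 0)"
          by (intro sum.cong) (auto simp: \<delta>_def)
        then show ?thesis using fin that by simp
      qed
      then show "\<phi> f b i j = (\<Sum>g\<in>carrier G. dsum_smult (f g) (\<phi> (\<delta> g))) b i j"
        by (auto simp: sum_fun_apply \<phi>_def dsum_smult_def intro!: sum.cong)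
    qed
    have inj_\<delta>: "inj_on (\<lambda>g. \<phi> (\<delta> g)) (carrier G)"
    proof (rule inj_onI)
      fix g h assume gh: "g \<in> carrier G" "h \<in> carrier G" "\<phi> (\<delta> g) = \<phi> (\<delta> h)"
      have "\<phi> (QG_add (\<delta> g) (QG_smult (-1) (\<delta> h))) = 0"
        unfolding \<phi>_add \<phi>_smult gh(3) by (simp add: fun_eq_iff dsum_add_def dsum_smult_def)
      from \<phi>_eq_0[OF this gh(1)] show "g = h"
        by (auto simp: QG_add_def QG_smult_def \<delta>_def split: if_splits)
    qed
    define B where "B = (\<lambda>g. \<phi> (\<delta> g)) ` carrier G"
    have finB: "finite B" and cardB: "card B = card (carrier G)"
      using fin inj_\<delta> by (simp_all add: B_def card_image)
    have sumB: "(\<Sum>v\<in>B. dsum_smult (c v) v) = \<phi> (\<lambda>g. c (\<phi> (\<delta> g)))" for c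
      unfolding \<phi>_sum[of "\<lambda>g. c (\<phi> (\<delta> g))"] B_def by (simp add: sum.reindex[OF inj_\<delta>])
    have indep: "V.independent B"
      unfolding V.dependent_finite[OF finB]
    proof safe
      fix c v assume "v \<in> B" "c v \<noteq> 0" and z: "(\<Sum>v\<in>B. dsum_smult (c v) v) = 0"
      then show False using \<phi>_eq_0[OF z[unfolded sumB]] by (auto simp: B_def)
    qed
    obtain T where T: "finite T" "card T \<le> (\<Sum>b<length L. fst (L ! b) ^ 2 * d b)"
        "dsum_carrier L \<subseteq> V.span T"
      by (rule dsum_carrier_subset_span[where L = L and d = d and w = w]) (use span in blast)+
    \<comment> \<open>A vector outside the span would give one more independent vector than the
      spanning set \<open>T\<close> allows.\<close>
    have "D \<in> V.span B"
    proof (rule ccontr)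
      assume notin: "D \<notin> V.span B"
      then have "V.independent (insert D B)" using indep by (rule V.independent_insertI)
      moreover have "insert D B \<subseteq> V.span T" using T(3) D \<phi>_carrier by (auto simp: B_def)
      ultimately have "card (insert D B) \<le> card T"
        using V.independent_span_bound[OF T(1)] by blast
      moreover have "D \<notin> B" using notin V.span_base by blast
      ultimately show False using T(2) card cardB finB by simp
    qed
    then obtain c where "D = (\<Sum>v\<in>B. dsum_smult (c v) v)"
      unfolding V.span_finite[OF finB] by blast
    then have D': "D = \<phi> (\<lambda>g. c (\<phi> (\<delta> g)))" by (simp only: sumB)
    \<comment> \<open>The map ignores values outside the group, but \<open>QG_carrier\<close>
      requires them to be 0.\<close>
    define f where "f g = (if g \<in> carrier G then c (\<phi> (\<delta> g)) else 0)" for g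
    have "\<phi> f = D" unfolding D' by (auto simp: \<phi>_def f_def fun_eq_iff)
    moreover have "f \<in> QG_carrier G" by (simp add: QG_carrier_def f_def)
    ultimately show "D \<in> \<phi> ` QG_carrier G" by blast
  qed (use \<phi>_carrier in blast)
  ultimately have "bij_betw \<phi> (QG_carrier G) (dsum_carrier L)" by (simp add: bij_betw_def)
  then show ?thesis
    unfolding QG_iso_dsum_def using \<phi>_add \<phi>_mult \<phi>_smult \<phi>_one by blast
qed

section \<open>The metacyclic group\<close>

text \<open>The words y^j x^i contain the generators and their inverses and are closed under
  products, so \<open>a * b\<close> of them cover the group. As the group has exactly that many
  elements, the covering is a bijection: prescribing the order makes the normal form unique.\<close>

lemma (in group) metacyclic_normal_form:
  fixes q a b :: nat
  assumes x: "x \<in> carrier G" and y: "y \<in> carrier G"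
    and gen: "generate G {x, y} = carrier G"
    and xa: "x [^] a = \<one>" and yb: "y [^] b = \<one>"
    and twist: "x \<otimes> y = y \<otimes> x [^] q"
    and fin: "finite (carrier G)" and card: "card (carrier G) = a * b"
  obtains J I :: "'a \<Rightarrow> nat" where "\<And>g. g \<in> carrier G \<Longrightarrow> g = y [^] J g \<otimes> x [^] I g"
    "\<And>(j :: nat) (i :: nat). J (y [^] j \<otimes> x [^] i) = j mod b" "\<And>(j :: nat) (i :: nat). I (y [^] j \<otimes> x [^] i) = i mod a"
proof -
  have pos: "a > 0" "b > 0"
    using card fin by (metis card_gt_0_iff mult_is_0 neq0_conv one_closed empty_iff)+
  have red: "z [^] k = z [^] (k mod m)" if "z \<in> carrier G" "z [^] m = \<one>" for z and k m :: nat
  proof -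
    have "z [^] (m * (k div m) + k mod m) = (z [^] m) [^] (k div m) \<otimes> z [^] (k mod m)"
      using that(1) by (simp only: nat_pow_mult nat_pow_pow)
    then show ?thesis using that by simp
  qed
  define f where "f = (\<lambda>(j, i). y [^] (j :: nat) \<otimes> x [^] (i :: nat))"
  have f_mod: "f (j, i) = f (j mod b, i mod a)" for j i
    unfolding f_def prod.case using red[OF y yb, of j] red[OF x xa, of i] by simp
  have f_mult: "f (j, i) \<otimes> f (j', i') = f (j + j', i * q ^ j' + i')" for j i j' i'
    unfolding f_def prod.case by (rule twisted_normal_mult[OF x y twist])
  have "inv x = f (0, a - 1)"
  proof -
    have "x [^] (a - 1) \<otimes> x = \<one>" using xa pos x by (metis Suc_pred' nat_pow_Suc)
    then show ?thesis using x by (simp add: f_def inv_equality)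
  qed
  moreover have "inv y = f (b - 1, 0)"
  proof -
    have "y [^] (b - 1) \<otimes> y = \<one>" using yb pos y by (metis Suc_pred' nat_pow_Suc)
    then show ?thesis using y by (simp add: f_def inv_equality)
  qed
  moreover have "x = f (0, 1)" "y = f (1, 0)" "\<one> = f (0, 0)" using x y by (simp_all add: f_def)
  ultimately have mem: "x \<in> range f" "y \<in> range f" "\<one> \<in> range f" "inv x \<in> range f" "inv y \<in> range f"
    by (metis rangeI)+
  have "g \<in> range f" if "g \<in> generate G {x, y}" for g
    using that
  proof (induction rule: generate.induct)
    case (eng h1 h2)
    then obtain u v where "h1 = f u" "h2 = f v" by blast
    then show ?case using f_mult by (cases u; cases v) auto
  qed (use mem in auto)
  then have "carrier G \<subseteq> f ` ({..<b} \<times> {..<a})"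
    unfolding gen[symmetric] using f_mod pos by (fastforce intro: image_eqI)
  moreover have "f ` ({..<b} \<times> {..<a}) \<subseteq> carrier G" using x y by (auto simp: f_def)
  ultimately have img: "f ` ({..<b} \<times> {..<a}) = carrier G" by blast
  then have inj: "inj_on f ({..<b} \<times> {..<a})"
    using card by (intro eq_card_imp_inj_on) (simp_all add: mult.commute)
  define h where "h = the_inv_into ({..<b} \<times> {..<a}) f"
  have hf: "h (f (j, i)) = (j mod b, i mod a)" for j i
    unfolding f_mod[of j i] h_def using pos by (intro the_inv_into_f_f[OF inj]) auto
  have fh: "f (h g) = g" if "g \<in> carrier G" for g
    unfolding h_def using that img by (intro f_the_inv_into_f[OF inj]) auto
  show thesis
  proof (rule that[of "\<lambda>g. fst (h g)" "\<lambda>g. snd (h g)"])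
    show "g = y [^] fst (h g) \<otimes> x [^] snd (h g)" if "g \<in> carrier G" for g
      using fh[OF that] by (simp add: f_def case_prod_beta)
    show "fst (h (y [^] j \<otimes> x [^] i)) = j mod b" for j i :: nat
      using hf[of j i] by (simp add: f_def)
    show "snd (h (y [^] j \<otimes> x [^] i)) = i mod a" for j i :: nat
      using hf[of j i] by (simp add: f_def)
  qed
qed

text \<open>The side conditions for the matrices to exist, for \<alpha> to be a p-th root of unity
  that is primitive when \<open>r > 0\<close>, and, in the last conclusion, for y^(p^n) to act
  trivially.\<close>

lemma rep_params_valid:
  assumes "n \<ge> 1" "(r, M, s, t) \<in> set (rep_params p n)" "Factorial_Ring.prime p"
  shows "r \<le> n" "M = 0 \<Longrightarrow> r = 0" "M = 0 \<Longrightarrow> s = 0" "r > 0 \<Longrightarrow> \<not> p dvd s" "p ^ M dvd t * p ^ (n - r)"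
proof -
  have p1: "p > 1" using assms(3) prime_gt_1_nat by blast
  have s: "\<not> p dvd s" if "1 \<le> s" "s < p" for s using that by (auto dest: dvd_imp_le)
  show "r \<le> n" "M = 0 \<Longrightarrow> r = 0" "M = 0 \<Longrightarrow> s = 0" "r > 0 \<Longrightarrow> \<not> p dvd s"
    using assms(1,2) p1 s by (auto simp: rep_params_def)
  \<comment> \<open>Only the last parameter, with r = n and M = 1, violates the inequality, and it
    has t = 0.\<close>
  have "M \<le> n - r \<or> t = 0"
    using assms(1,2) by (auto simp: rep_params_def)
  then show "p ^ M dvd t * p ^ (n - r)" by (auto simp: le_imp_power_dvd)
qed

section \<open>Representations of the group and the joint kernel\<close>

lemma elements_mat_mult_subfield:
  assumes K: "is_subfield_of_complex K" and A: "A \<in> carrier_mat n m" "elements_mat A \<subseteq> K"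
    and B: "B \<in> carrier_mat m k" "elements_mat B \<subseteq> K"
  shows "elements_mat (A * B) \<subseteq> K"
proof
  fix z assume "z \<in> elements_mat (A * B)"
  then obtain i j where ij: "i < n" "j < k" "z = (A * B) $$ (i, j)" using A(1) B(1) by (auto simp: elements_mat_def)
  then have "z = (\<Sum>l<m. A $$ (i, l) * B $$ (l, j))"
    using A(1) B(1) by (simp add: scalar_prod_def atLeast0LessThan)
  moreover have "A $$ (i, l) \<in> K" "B $$ (l, j) \<in> K" if "l < m" for l
    using A B ij that elements_matI by blast+
  then have "(\<Sum>l<m. A $$ (i, l) * B $$ (l, j)) \<in> K"
    using K by (intro subfield_sum[OF K]) (auto simp: is_subfield_of_complex_def)
  ultimately show "z \<in> K" by simp
qed

lemma elements_mat_pow_subfield: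
  assumes K: "is_subfield_of_complex K" and A: "A \<in> carrier_mat n n" "elements_mat A \<subseteq> K"
  shows "elements_mat (A ^\<^sub>m k) \<subseteq> K"
proof (induction k)
  case 0
  show ?case using K by (auto simp: elements_mat_def is_subfield_of_complex_def)
next
  case (Suc k)
  then show ?case
    using elements_mat_mult_subfield[OF K pow_carrier_mat[OF A(1)] Suc A] by simp
qed

locale metacyclic_p_group = group G for G :: "('a, 'b) monoid_scheme" (structure) +
  fixes p n :: nat and x y :: 'a and J I :: "'a \<Rightarrow> nat"
  assumes prime_p: "Factorial_Ring.prime p" and odd_p: "odd p" and n: "n \<ge> 1"
    and x: "x \<in> carrier G" and y: "y \<in> carrier G"
    and twist: "x \<otimes> y = y \<otimes> x [^] (1 + p)"
    and fin: "finite (carrier G)" and card: "card (carrier G) = p ^ (2 * n + 1)"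
    and normal_form: "\<And>g. g \<in> carrier G \<Longrightarrow> g = y [^] J g \<otimes> x [^] I g"
    and J: "\<And>(j :: nat) (i :: nat). J (y [^] j \<otimes> x [^] i) = j mod p ^ n"
    and I: "\<And>(j :: nat) (i :: nat). I (y [^] j \<otimes> x [^] i) = i mod p ^ (n + 1)"
begin

lemma exponents_one: "J \<one> = 0" "I \<one> = 0"
  using J[of 0 0] I[of 0 0] x y by simp_all

lemma exponents_dvd_iff:
  assumes "g \<in> carrier G"
  shows "p ^ (n + 1) dvd I g \<and> p ^ n dvd J g \<longleftrightarrow> g = \<one>"
proof
  assume dvd: "p ^ (n + 1) dvd I g \<and> p ^ n dvd J g"
  have "I g = I g mod p ^ (n + 1)" "J g = J g mod p ^ n"
    using I[of "J g" "I g"] J[of "J g" "I g"] normal_form[OF assms, symmetric] by simp_all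
  then have "I g = 0" "J g = 0" using dvd by (simp_all only: dvd_imp_mod_0)
  then show "g = \<one>" using normal_form[OF assms] x y by simp
qed (simp add: exponents_one)

definition is_rep :: "rep_param \<Rightarrow> ('a \<Rightarrow> complex mat) \<Rightarrow> bool" where
  "is_rep = (\<lambda>(r, M, s, t) \<rho>. (\<forall>g. \<rho> g \<in> carrier_mat (p ^ r) (p ^ r)) \<and>
      (\<forall>g\<in>carrier G. \<forall>h\<in>carrier G. \<rho> (g \<otimes> h) = \<rho> g * \<rho> h) \<and> \<rho> \<one> = 1\<^sub>m (p ^ r) \<and>
      (\<forall>g. elements_mat (\<rho> g) \<subseteq> cyclotomic_field (p ^ M)) \<and>
      (\<forall>g. mat_trace (\<rho> g) = (if p ^ r dvd I g \<and> p ^ r dvd J g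
          then of_nat (p ^ r) * zeta (p ^ M) ^ rep_exponent p (r, M, s, t) (I g) (J g) else 0)))"

lemma exists_rep:
  assumes q: "(r, M, s, t) \<in> set (rep_params p n)"
  shows "\<exists>\<rho>. is_rep (r, M, s, t) \<rho>"
proof -
  note valid = rep_params_valid[OF n q prime_p]
  obtain A B where AB: "A \<in> carrier_mat (p ^ r) (p ^ r)" "B \<in> carrier_mat (p ^ r) (p ^ r)"
    "elements_mat A \<subseteq> cyclotomic_field (p ^ M)" "elements_mat B \<subseteq> cyclotomic_field (p ^ M)"
    "A * B = B * A ^\<^sub>m (1 + p)"
    "A ^\<^sub>m (p ^ r) = zeta (p ^ M) ^ (s * p ^ (M - 1)) \<cdot>\<^sub>m 1\<^sub>m (p ^ r)"
    "B ^\<^sub>m (p ^ r) = zeta (p ^ M) ^ t \<cdot>\<^sub>m 1\<^sub>m (p ^ r)"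
    by (rule exists_rep_matrices[OF prime_p odd_p valid(2), where s = s and t = t])
  have p0: "p > 0" using prime_p prime_gt_0_nat by blast
  then have pM: "p ^ M > 0" by simp
  define \<alpha> \<beta> where \<alpha>\<beta>: "\<alpha> = zeta (p ^ M) ^ (s * p ^ (M - 1))" "\<beta> = zeta (p ^ M) ^ t"
  interpret rep: twisted_pair p r A B \<alpha> \<beta>
  proof
    have "p ^ M dvd s * p ^ (M - 1) * p"
      using valid(3) by (cases M) auto
    then show "\<alpha> ^ p = 1"
      using pM by (simp add: \<alpha>\<beta> zeta_power_eq_1_iff flip: power_mult)
    show "\<alpha> ^ w \<noteq> 1" if w: "r > 0" "\<not> p dvd w" for w
    proof
      assume "\<alpha> ^ w = 1"
      then have "p ^ M dvd s * p ^ (M - 1) * w"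
        using pM by (simp add: \<alpha>\<beta> zeta_power_eq_1_iff flip: power_mult)
      moreover obtain k where "M = Suc k" using valid(2) w by (metis not0_implies_Suc less_irrefl)
      ultimately have "p dvd s * w" using p0 by (simp add: mult_ac)
      then show False using valid(4) w prime_p by (simp add: prime_dvd_mult_iff)
    qed
  qed (use AB prime_p odd_p in \<open>simp_all add: \<alpha>\<beta> zeta_def\<close>)
  \<comment> \<open>The matrices satisfy the order relations of the group, so they depend only on
    the reduced exponents; this makes the assignment through \<open>J\<close> and \<open>I\<close>
    multiplicative. For \<open>A\<close> it uses n + 1 - r >= 1 and \<alpha>^p = 1.\<close>
  have rep_mod: "rep.rep (j mod p ^ n) (i mod p ^ (n + 1)) = rep.rep j i" for j i
  proof -
    have "\<beta> ^ p ^ (n - r) = 1"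
      using valid(5) pM by (simp add: \<alpha>\<beta> zeta_power_eq_1_iff flip: power_mult)
    moreover have "\<alpha> ^ p ^ (n + 1 - r) = (\<alpha> ^ p) ^ p ^ (n - r)"
      using valid(1) by (simp add: Suc_diff_le flip: power_mult)
    ultimately have roots: "\<alpha> ^ (p ^ (n + 1 - r) * k) = 1" "\<beta> ^ (p ^ (n - r) * k) = 1" for k
      using rep.\<alpha>_pow by (simp_all add: power_mult)
    have "p ^ n = p ^ r * p ^ (n - r)" "p ^ (n + 1) = p ^ r * p ^ (n + 1 - r)"
      using valid(1) by (metis le_add_diff_inverse power_add, metis le_add_diff_inverse power_add trans_le_add1)
    then have "rep.rep (j mod p ^ n + p ^ n * (j div p ^ n)) (i mod p ^ (n + 1) + p ^ (n + 1) * (i div p ^ (n + 1))) =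
        1 \<cdot>\<^sub>m rep.rep (j mod p ^ n) (i mod p ^ (n + 1))"
      using rep.rep_add_multiple[of "j mod p ^ n" "p ^ (n - r) * (j div p ^ n)"
          "i mod p ^ (n + 1)" "p ^ (n + 1 - r) * (i div p ^ (n + 1))"] roots
      by (simp only: mult.assoc mult_1_right)
    also have "\<dots> = rep.rep (j mod p ^ n) (i mod p ^ (n + 1))" by (intro eq_matI) auto
    finally show ?thesis by (simp only: mod_mult_div_eq)
  qed
  define \<rho> where "\<rho> g = rep.rep (J g) (I g)" for g
  have "\<rho> (g \<otimes> h) = \<rho> g * \<rho> h" if "g \<in> carrier G" "h \<in> carrier G" for g h
  proof -
    have "g \<otimes> h = (y [^] J g \<otimes> x [^] I g) \<otimes> (y [^] J h \<otimes> x [^] I h)"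
      by (simp only: normal_form[OF that(1), symmetric] normal_form[OF that(2), symmetric])
    also have "\<dots> = y [^] (J g + J h) \<otimes> x [^] (I g * (1 + p) ^ J h + I h)"
      by (rule twisted_normal_mult[OF x y twist])
    finally have "g \<otimes> h = y [^] (J g + J h) \<otimes> x [^] (I g * (1 + p) ^ J h + I h)" .
    then show ?thesis by (simp only: \<rho>_def J I rep_mod rep.rep_mult)
  qed
  moreover have "\<rho> g \<in> carrier_mat (p ^ r) (p ^ r)" for g by (simp add: \<rho>_def)
  moreover have "\<rho> \<one> = 1\<^sub>m (p ^ r)" by (simp add: \<rho>_def exponents_one rep.rep_00)
  moreover have "elements_mat (\<rho> g) \<subseteq> cyclotomic_field (p ^ M)" for g
    unfolding \<rho>_def rep.rep_def
    by (rule elements_mat_mult_subfield[OF subfield_cyclotomic_field rep.pow_carrier(2) _ rep.pow_carrier(1)])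
      (intro elements_mat_pow_subfield[OF subfield_cyclotomic_field, where n = "p ^ r"] AB)+
  moreover have "mat_trace (\<rho> g) = (if p ^ r dvd I g \<and> p ^ r dvd J g
        then of_nat (p ^ r) * zeta (p ^ M) ^ rep_exponent p (r, M, s, t) (I g) (J g) else 0)" for g
    unfolding \<rho>_def rep.mat_trace_rep by (simp add: \<alpha>\<beta> power_add power_mult)
  ultimately have "is_rep (r, M, s, t) \<rho>" unfolding is_rep_def prod.case by blast
  then show ?thesis by (intro exI[of _ \<rho>])
qed


fun rep_size :: "rep_param \<Rightarrow> nat" where
  "rep_size (r, M, s, t) = p ^ r"

fun rep_level :: "rep_param \<Rightarrow> nat" where
  "rep_level (r, M, s, t) = M"

lemma rep_block_eq: "rep_block p q = (rep_size q, p ^ rep_level q)"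
  by (cases q) simp

text \<open>The sum of the rational traces of the characters, weighted by their degrees, is the
  regular character, so an element killed by all representations has vanishing coefficients.\<close>
lemma joint_kernel_trivial:
  assumes rep: "\<And>q. q \<in> set (rep_params p n) \<Longrightarrow> is_rep q (\<rho> q)"
    and zero: "\<And>q i j. q \<in> set (rep_params p n) \<Longrightarrow> i < rep_size q \<Longrightarrow> j < rep_size q \<Longrightarrow>
        (\<Sum>g\<in>carrier G. of_rat (f g) * \<rho> q g $$ (i, j)) = 0"
    and h: "h \<in> carrier G"
  shows "f h = 0"
proof -
  define c where "c q g = rep_weight p q (I g) (J g)" for q g
  have "(\<Sum>g\<in>carrier G. f g * of_int (c q (g \<otimes> inv h))) = 0" if q: "q \<in> set (rep_params p n)" for q
  proof -
    obtain r M s t where q_eq: "q = (r, M, s, t)" by (cases q)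
    note R = rep[OF q, unfolded is_rep_def q_eq prod.case, folded q_eq]
    define S where "S = {g \<in> carrier G. p ^ r dvd I (g \<otimes> inv h) \<and> p ^ r dvd J (g \<otimes> inv h)}"
    define e where "e g = rep_exponent p q (I (g \<otimes> inv h)) (J (g \<otimes> inv h))" for g
    have dims: "\<rho> q g \<in> carrier_mat (p ^ r) (p ^ r)" for g using R by blast
    \<comment> \<open>The matrix of \<open>f\<close> is zero, hence so is its product with the
      matrix of \<open>inv h\<close>. This translation moves \<open>h\<close> to the identity, where
      the regular character is supported.\<close>
    have "(\<Sum>g\<in>carrier G. of_rat (f g) * mat_trace (\<rho> q (g \<otimes> inv h))) =
        (\<Sum>g\<in>carrier G. \<Sum>i<p ^ r. \<Sum>l<p ^ r. (of_rat (f g) * \<rho> q g $$ (i, l)) * \<rho> q (inv h) $$ (l, i))"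
    proof (rule sum.cong[OF refl])
      fix g assume g: "g \<in> carrier G"
      have "\<rho> q (g \<otimes> inv h) = \<rho> q g * \<rho> q (inv h)" using R g h by simp
      then show "of_rat (f g) * mat_trace (\<rho> q (g \<otimes> inv h)) =
          (\<Sum>i<p ^ r. \<Sum>l<p ^ r. (of_rat (f g) * \<rho> q g $$ (i, l)) * \<rho> q (inv h) $$ (l, i))"
        using dims[of g] dims[of "inv h"]
        by (simp add: mat_trace_def scalar_prod_def atLeast0LessThan sum_distrib_left mult.assoc)
    qed
    also have "\<dots> = (\<Sum>i<p ^ r. \<Sum>l<p ^ r. (\<Sum>g\<in>carrier G. of_rat (f g) * \<rho> q g $$ (i, l)) * \<rho> q (inv h) $$ (l, i))"
      by (simp only: sum.swap[of _ _ "carrier G"] sum_distrib_right)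
    also have "\<dots> = 0" using zero[OF q] by (simp add: q_eq)
    finally have "(\<Sum>g\<in>carrier G. of_rat (f g) * mat_trace (\<rho> q (g \<otimes> inv h))) = 0" .
    also have "(\<Sum>g\<in>carrier G. of_rat (f g) * mat_trace (\<rho> q (g \<otimes> inv h))) =
        (\<Sum>g\<in>S. of_rat (f g) * (of_nat (p ^ r) * zeta (p ^ M) ^ e g))"
      using R fin by (intro sum.mono_neutral_cong_right) (auto simp: S_def e_def q_eq)
    also have "\<dots> = of_nat (p ^ r) * (\<Sum>g\<in>S. of_rat (f g) * zeta (p ^ M) ^ e g)"
      by (simp add: sum_distrib_left mult_ac)
    finally have "(\<Sum>g\<in>S. of_rat (f g) * zeta (p ^ M) ^ e g) = 0"
      using prime_p prime_gt_0_nat by auto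
    \<comment> \<open>After cancelling the degree, the relation is one between powers of zeta_(p^M)
      with rational coefficients, so it passes to rational traces; multiplying by p^(2r) then
      restores the weights.\<close>
    from zeta_relation_ramanujan[OF prime_p this]
    have "of_int (int p ^ (2 * r)) * (\<Sum>g\<in>S. f g * of_int (ramanujan_pp p M (e g))) = 0" by simp
    also have "of_int (int p ^ (2 * r)) * (\<Sum>g\<in>S. f g * of_int (ramanujan_pp p M (e g))) =
        (\<Sum>g\<in>carrier G. f g * of_int (c q (g \<otimes> inv h)))"
      unfolding sum_distrib_left using fin
      by (intro sum.mono_neutral_cong_left) (auto simp: S_def e_def c_def q_eq)
    finally show ?thesis .
  qed
  then have "sum_list (map (\<lambda>q. \<Sum>g\<in>carrier G. f g * of_int (c q (g \<otimes> inv h))) (rep_params p n)) = 0"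
    by (intro sum_list_neutral) auto
  also have "sum_list (map (\<lambda>q. \<Sum>g\<in>carrier G. f g * of_int (c q (g \<otimes> inv h))) xs) =
      (\<Sum>g\<in>carrier G. f g * of_int (sum_list (map (\<lambda>q. c q (g \<otimes> inv h)) xs)))" for xs
    by (induction xs) (simp_all add: sum.distrib algebra_simps)
  also have "(\<Sum>g\<in>carrier G. f g * of_int (sum_list (map (\<lambda>q. c q (g \<otimes> inv h)) (rep_params p n)))) =
      (\<Sum>g\<in>carrier G. if g = h then f h * of_nat p ^ (2 * n + 1) else 0)"
  proof (rule sum.cong[OF refl])
    fix g assume g: "g \<in> carrier G"
    have "g \<otimes> inv h = \<one> \<longleftrightarrow> g = h" using inv_solve_right'[of \<one> g h] g h by auto
    then show "f g * of_int (sum_list (map (\<lambda>q. c q (g \<otimes> inv h)) (rep_params p n))) =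
        (if g = h then f h * of_nat p ^ (2 * n + 1) else 0)"
      using exponents_dvd_iff[of "g \<otimes> inv h"] g h
      unfolding c_def sum_rep_weight[OF prime_p n] by auto
  qed
  also have "\<dots> = f h * of_nat p ^ (2 * n + 1)" using fin h by simp
  finally show ?thesis using prime_p prime_gt_0_nat by auto
qed

text \<open>The dimension count is the regular character at the identity.\<close>
lemma sum_block_dimensions:
  "(\<Sum>b<length (rep_params p n). rep_size (rep_params p n ! b) ^ 2 *
      Polynomial.degree (pp_min_poly p (rep_level (rep_params p n ! b)))) = card (carrier G)"
proof -
  have p0: "p > 0" using prime_p prime_gt_0_nat by blast
  have "int (rep_size q ^ 2 * Polynomial.degree (pp_min_poly p (rep_level q))) = rep_weight p q 0 0" for q
    by (cases q) (simp add: int_degree_pp_min_poly[OF p0] power_mult mult.commute)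
  then have "int (\<Sum>b<length (rep_params p n). rep_size (rep_params p n ! b) ^ 2 *
      Polynomial.degree (pp_min_poly p (rep_level (rep_params p n ! b)))) =
      (\<Sum>b<length (rep_params p n). rep_weight p (rep_params p n ! b) 0 0)"
    by (simp only: of_nat_sum)
  also have "\<dots> = sum_list (map (\<lambda>q. rep_weight p q 0 0) (rep_params p n))"
    by (simp add: sum_list_sum_nth atLeast0LessThan)
  also have "\<dots> = int (card (carrier G))"
    unfolding sum_rep_weight[OF prime_p n] card by simp
  finally show ?thesis by (simp only: of_nat_eq_iff)
qed

lemma QG_iso_thm54_blocks: "QG_iso_dsum G (thm54_blocks p n)"
proof -
  define P where "P = rep_params p n"
  have L: "thm54_blocks p n ! b = (rep_size (P ! b), p ^ rep_level (P ! b))" if "b < length P" for b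
    using that unfolding map_rep_block_rep_params[symmetric] P_def by (simp add: rep_block_eq)
  have "\<forall>q\<in>set P. \<exists>\<rho>. is_rep q \<rho>" using exists_rep by (auto simp: P_def)
  then obtain \<rho> where rep: "q \<in> set P \<Longrightarrow> is_rep q (\<rho> q)" for q by metis
  have \<rho>: "\<rho> q g \<in> carrier_mat (rep_size q) (rep_size q)"
      "g \<in> carrier G \<Longrightarrow> h \<in> carrier G \<Longrightarrow> \<rho> q (g \<otimes> h) = \<rho> q g * \<rho> q h"
      "\<rho> q \<one> = 1\<^sub>m (rep_size q)" "elements_mat (\<rho> q g) \<subseteq> cyclotomic_field (p ^ rep_level q)"
    if "q \<in> set P" for q g h
    using rep[OF that] by (cases q; simp add: is_rep_def)+
  have len: "length (thm54_blocks p n) = length P"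
    unfolding map_rep_block_rep_params[symmetric] P_def by simp
  show ?thesis
  proof (rule QG_iso_dsum_criterion[OF fin, where \<rho> = "\<lambda>b. \<rho> (P ! b)"
        and d = "\<lambda>b. Polynomial.degree (pp_min_poly p (rep_level (P ! b)))"
        and w = "\<lambda>b k. zeta (p ^ rep_level (P ! b)) ^ k"])
    fix b assume "b < length (thm54_blocks p n)"
    then have b: "b < length P" and q: "P ! b \<in> set P" by (simp_all add: len)
    note [simp] = L[OF b]
    show "\<rho> (P ! b) g \<in> carrier_mat (fst (thm54_blocks p n ! b)) (fst (thm54_blocks p n ! b))" for g
      using \<rho>(1)[OF q] by simp
    show "\<rho> (P ! b) (g \<otimes> h) = \<rho> (P ! b) g * \<rho> (P ! b) h" if "g \<in> carrier G" "h \<in> carrier G" for g h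
      using \<rho>(2)[OF q that] .
    show "\<rho> (P ! b) \<one> = 1\<^sub>m (fst (thm54_blocks p n ! b))" using \<rho>(3)[OF q] by simp
    show "(\<Sum>g\<in>carrier G. of_rat (f g) * \<rho> (P ! b) g $$ (i, j)) \<in> cyclotomic_field (snd (thm54_blocks p n ! b))"
      if "i < fst (thm54_blocks p n ! b)" "j < fst (thm54_blocks p n ! b)" for f i j
    proof -
      let ?K = "cyclotomic_field (p ^ rep_level (P ! b))"
      have K: "is_subfield_of_complex ?K" by (rule subfield_cyclotomic_field)
      have "\<rho> (P ! b) g $$ (i, j) \<in> ?K" for g
        using that \<rho>(1)[OF q, of g] \<rho>(4)[OF q, of g] by (auto intro: elements_matI)
      then have "(\<Sum>g\<in>carrier G. of_rat (f g) * \<rho> (P ! b) g $$ (i, j)) \<in> ?K"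
        using K subfield_of_rat[OF K] by (intro subfield_sum[OF K]) (auto simp: is_subfield_of_complex_def)
      then show ?thesis by simp
    qed
    show "\<exists>a :: nat \<Rightarrow> rat. z = (\<Sum>k<Polynomial.degree (pp_min_poly p (rep_level (P ! b))).
        of_rat (a k) * zeta (p ^ rep_level (P ! b)) ^ k)"
      if "z \<in> cyclotomic_field (snd (thm54_blocks p n ! b))" for z
    proof -
      have "z \<in> cyclotomic_field (p ^ rep_level (P ! b))" using that by simp
      then show ?thesis by (rule cyclotomic_field_prime_powerE[OF prime_p]) blast
    qed
  next
    fix f g
    assume zero: "\<And>b i j. b < length (thm54_blocks p n) \<Longrightarrow> i < fst (thm54_blocks p n ! b) \<Longrightarrow>
        j < fst (thm54_blocks p n ! b) \<Longrightarrow> (\<Sum>g\<in>carrier G. of_rat (f g) * \<rho> (P ! b) g $$ (i, j)) = 0"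
      and g: "g \<in> carrier G"
    show "f g = 0"
    proof (rule joint_kernel_trivial[OF _ _ g, where \<rho> = \<rho>])
      show "is_rep q (\<rho> q)" if "q \<in> set (rep_params p n)" for q using rep that by (simp add: P_def)
      show "(\<Sum>g\<in>carrier G. of_rat (f g) * \<rho> q g $$ (i, j)) = 0"
        if q: "q \<in> set (rep_params p n)" and ij: "i < rep_size q" "j < rep_size q" for q i j
      proof -
        obtain b where b: "b < length P" "q = P ! b" using q by (metis P_def in_set_conv_nth)
        then show ?thesis using zero[of b i j] ij by (simp add: len L[OF b(1)])
      qed
    qed
  next
    show "(\<Sum>b<length (thm54_blocks p n). fst (thm54_blocks p n ! b) ^ 2 *
        Polynomial.degree (pp_min_poly p (rep_level (P ! b)))) \<le> card (carrier G)"
      using sum_block_dimensions unfolding len by (simp add: L P_def[symmetric])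
  qed
qed

end

theorem theorem5p4:
  fixes G :: "'a monoid" and x y :: 'a and p n :: nat
  assumes "Factorial_Ring.prime p" and "odd p" and "n \<ge> 1"
    and "group G"
    and "x \<in> carrier G" and "y \<in> carrier G"
    and "generate G {x, y} = carrier G"
    and "x [^]\<^bsub>G\<^esub> (p ^ (n + 1)) = \<one>\<^bsub>G\<^esub>"
    and "y [^]\<^bsub>G\<^esub> (p ^ n) = \<one>\<^bsub>G\<^esub>"
    and "inv\<^bsub>G\<^esub> y \<otimes>\<^bsub>G\<^esub> x \<otimes>\<^bsub>G\<^esub> y = x [^]\<^bsub>G\<^esub> (1 + p)"
    and "finite (carrier G)" and "card (carrier G) = p ^ (2 * n + 1)"
  shows "QG_iso_dsum G (thm54_blocks p n)"
proof -
  interpret group G by fact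
  have twist: "x \<otimes>\<^bsub>G\<^esub> y = y \<otimes>\<^bsub>G\<^esub> x [^]\<^bsub>G\<^esub> (1 + p)"
    unfolding assms(10)[symmetric] using assms(5,6) by (simp add: m_assoc[symmetric])
  have card: "card (carrier G) = p ^ (n + 1) * p ^ n"
    unfolding assms(12) by (simp add: mult_2 power_add)
  obtain J I where "metacyclic_p_group G p n x y J I"
  proof (rule metacyclic_normal_form[OF assms(5-9) twist assms(11) card])
    fix J I :: "'a \<Rightarrow> nat"
    assume "\<And>g. g \<in> carrier G \<Longrightarrow> g = y [^]\<^bsub>G\<^esub> J g \<otimes>\<^bsub>G\<^esub> x [^]\<^bsub>G\<^esub> I g"
      "\<And>(j :: nat) (i :: nat). J (y [^]\<^bsub>G\<^esub> j \<otimes>\<^bsub>G\<^esub> x [^]\<^bsub>G\<^esub> i) = j mod p ^ n"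
      "\<And>(j :: nat) (i :: nat). I (y [^]\<^bsub>G\<^esub> j \<otimes>\<^bsub>G\<^esub> x [^]\<^bsub>G\<^esub> i) = i mod p ^ (n + 1)"
    then have "metacyclic_p_group G p n x y J I"
      using assms twist by unfold_locales
    then show thesis by (rule that)
  qed
  then show ?thesis by (rule metacyclic_p_group.QG_iso_thm54_blocks)
qed

end
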